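(* Let $m$ be a rational solution of the half-wave maps equation with $N\ge1$ solitons on $[0,\infty)$ (in the sense of the context), with poles $x_1,\dots,x_N$. Assume that the poles are separated: there exists $\eta>0$ such that for all $j\ne k$ and all $t>0$, $|\mathrm{Re}(x_k(t))-\mathrm{Re}(x_j(t))|\ge\eta$. Let $J\subseteq\{1,\dots,N\}$ be the set of indices $j$ for which there exists a sequence of times $t_n^j\to\infty$ with $\mathrm{Im}(x_j(t_n^j))\to0$ as $n\to\infty$. Then for every $j\in J$ there exist $C_j>0$ and $D_j>0$ such that for all $t>0$, $$\mathrm{Im}(x_j(t))\ge C_je^{-D_jt}.$$
   Context: Notation: for $u,v\in\mathbb{C}^3$, $u\cdot v=u_1v_1+u_2v_2+u_3v_3$ and $u\times v$ are the complex-bilinear dot and cross products, $\bar u$ is the complex conjugate, $|u|=\sqrt{u\cdot\bar u}$. $\mathbb{C}^+$ is the open upper half plane. $\mathbb{S}^2\subset\mathbb{R}^3$ is the unit sphere. Half-wave maps equation: $m_t=m\times|\nabla|m$ for $m=m(x,t)\in\mathbb{S}^2$, $x\in\mathbb{R}$, where $\widehat{|\nabla|u}(\xi)=|\xi|\hat u(\xi)$. Rational solution with $N$ solitons on an interval $I\ni 0$: a solution $m:\mathbb{R}\times I\to\mathbb{S}^2$ of the form $$m(x,t)=m_0+i\sum_{j=1}^N\frac{s_j(t)}{x-x_j(t)}-i\sum_{j=1}^N\frac{\bar s_j(t)}{x-\bar x_j(t)},$$ with $m_0\in\mathbb{S}^2$ constant, smooth spins $s_j:I\to\mathbb{C}^3\setminus\{0\}$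 and smooth, pairwise distinct poles $x_j:I\to\mathbb{C}^+$, satisfying on $I$ $$\dot s_j=-2\sum_{k\neq j}\frac{s_j\times s_k}{(x_j-x_k)^2},\qquad \ddot x_j=4\sum_{k\ne j}\frac{s_j\cdot s_k}{(x_j-x_k)^3},$$ and at $t=0$ $$\dot x_j=\frac{s_j\times\bar s_j}{s_j\cdot\bar s_j}\cdot\Big(i m_0-\sum_{k\ne j}\frac{s_k}{x_j-x_k}+\sum_{k=1}^N\frac{\bar s_k}{x_j-\bar x_k}\Big).$$ Since $m$ is $\mathbb{S}^2$-valued one has the constraints $s_j\cdot s_j=0$ and $s_j\cdot\big(i m_0-\sum_{k\ne j}\frac{s_k}{x_j-x_k}+\sum_{k}\frac{\bar s_k}{x_j-\bar x_k}\big)=0$. *)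

theory Defs
  imports "HOL-Analysis.Analysis"
begin

subsection \<open>Vectors in complex 3-space\<close>

definition cvec :: "real ^ 3 \<Rightarrow> complex ^ 3" where
  "cvec v = (\<chi> i. complex_of_real (v $ i))"

definition cnjv :: "complex ^ 3 \<Rightarrow> complex ^ 3" where
  "cnjv v = (\<chi> i. cnj (v $ i))"

text \<open>The dot product is bilinear, not Hermitian, and differs from the real inner product
  of the library on this type; \<open>cross3\<close> of the library exists for real vectors only.\<close>

definition cdot :: "complex ^ 3 \<Rightarrow> complex ^ 3 \<Rightarrow> complex" where
  "cdot u v = (\<Sum>i\<in>UNIV. u $ i * v $ i)"

definition ccross :: "complex ^ 3 \<Rightarrow> complex ^ 3 \<Rightarrow> complex ^ 3" where
  "ccross u v = vector [u $ 2 * v $ 3 - u $ 3 * v $ 2,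
                        u $ 3 * v $ 1 - u $ 1 * v $ 3,
                        u $ 1 * v $ 2 - u $ 2 * v $ 1]"

definition smooth_on_interval :: "real set \<Rightarrow> (real \<Rightarrow> 'a::real_normed_vector) \<Rightarrow> bool" where
  "smooth_on_interval I f \<longleftrightarrow>
     (\<exists>D :: nat \<Rightarrow> real \<Rightarrow> 'a.
        (\<forall>t\<in>I. D 0 t = f t) \<and>
        (\<forall>n. \<forall>t\<in>I. (D n has_vector_derivative D (Suc n) t) (at t within I)))"

subsection \<open>The operator with Fourier symbol \<open>\<bar>\<xi>\<bar>\<close>\<close>

definition schwartz :: "(real \<Rightarrow> complex) \<Rightarrow> bool" where
  "schwartz \<phi> \<longleftrightarrow>
     (\<exists>D :: nat \<Rightarrow> real \<Rightarrow> complex.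
        D 0 = \<phi> \<and>
        (\<forall>n x. (D n has_vector_derivative D (Suc n) x) (at x)) \<and>
        (\<forall>n k. bounded (range (\<lambda>x. complex_of_real x ^ k * D n x))))"

definition fourier :: "(real \<Rightarrow> complex) \<Rightarrow> real \<Rightarrow> complex" where
  "fourier \<phi> \<xi> = (LINT x|lborel. exp (- \<i> * complex_of_real (\<xi> * x)) * \<phi> x)"

definition square_integrable :: "(real \<Rightarrow> complex) \<Rightarrow> bool" where
  "square_integrable f \<longleftrightarrow>
     f \<in> borel_measurable lborel \<and> integrable lborel (\<lambda>x. (cmod (f x))\<^sup>2)"

text \<open>The functions of interest decay only like \<open>1 / x\<close>, so their Fourier integral need not
  converge absolutely. The Fourier transform of a square integrable function is the square
  integrable function (unique almost everywhere) determined by duality with Schwartz functions.\<close>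

definition L2_fourier :: "(real \<Rightarrow> complex) \<Rightarrow> (real \<Rightarrow> complex) \<Rightarrow> bool" where
  "L2_fourier f v \<longleftrightarrow>
     square_integrable f \<and> square_integrable v \<and>
     (\<forall>\<phi>. schwartz \<phi> \<longrightarrow>
        (LINT \<xi>|lborel. v \<xi> * \<phi> \<xi>) = (LINT x|lborel. f x * fourier \<phi> x))"

text \<open>\<open>abs_nabla u g\<close> says that \<open>g\<close> is a representative of the image of \<open>u\<close>, for \<open>u\<close> a constant
  plus a square integrable function. The transform of the constant is supported at
  \<open>\<xi> = 0\<close>, where the symbol vanishes, so constants are mapped to \<open>0\<close>.\<close>

definition abs_nabla :: "(real \<Rightarrow> complex) \<Rightarrow> (real \<Rightarrow> complex) \<Rightarrow> bool" where
  "abs_nabla u g \<longleftrightarrow>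
     (\<exists>c f v. (\<forall>x. u x = c + f x) \<and> L2_fourier f v \<and>
        L2_fourier g (\<lambda>\<xi>. complex_of_real \<bar>\<xi>\<bar> * v \<xi>))"

subsection \<open>Half-wave maps and their rational solutions\<close>

text \<open>The half-wave maps equation, with a sign \<open>\<sigma>\<close> in front of the right-hand side;
  \<open>g x t\<close> is the value of the operator applied to \<open>m\<close> at time \<open>t\<close>.\<close>

definition half_wave_maps ::
  "real \<Rightarrow> real set \<Rightarrow> (real \<Rightarrow> real \<Rightarrow> real ^ 3) \<Rightarrow> bool" where
  "half_wave_maps \<sigma> I m \<longleftrightarrow>
     (\<forall>x. \<forall>t\<in>I. m x t \<in> sphere 0 1) \<and>
     (\<exists>g :: real \<Rightarrow> real \<Rightarrow> real ^ 3. \<forall>t\<in>I.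
        (\<forall>i. abs_nabla (\<lambda>x. complex_of_real (m x t $ i)) (\<lambda>x. complex_of_real (g x t $ i))) \<and>
        (\<forall>x. (m x has_vector_derivative \<sigma> *\<^sub>R cross3 (m x t) (g x t)) (at t within I)))"

definition pole_field ::
  "nat \<Rightarrow> real ^ 3 \<Rightarrow> (nat \<Rightarrow> real \<Rightarrow> complex ^ 3) \<Rightarrow> (nat \<Rightarrow> real \<Rightarrow> complex) \<Rightarrow>
   nat \<Rightarrow> real \<Rightarrow> complex ^ 3" where
  "pole_field N m0 s x j t =
     \<i> *s cvec m0
     - (\<Sum>k\<in>{1..N} - {j}. (1 / (x j t - x k t)) *s s k t)
     + (\<Sum>k\<in>{1..N}. (1 / (x j t - cnj (x k t))) *s cnjv (s k t))"

text \<open>The literature writes the equation with \<open>\<sigma> = 1\<close> and also states the pole dynamics with the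
  signs used below. With the symbol \<open>\<bar>\<xi>\<bar>\<close> and poles in the upper half plane these two signs are not
  compatible: matching the double poles at \<open>x j t\<close> shows that the dynamics below belongs to
  \<open>\<sigma> = - 1\<close> (equivalently, to the Hilbert transform with kernel \<open>1 / (y - x)\<close>, applied to the
  space derivative of \<open>m\<close>), whereas \<open>\<sigma> = 1\<close> forces all poles and spins to be constant in time.
  The sign is therefore left as a parameter.\<close>

definition rational_solution ::
  "real \<Rightarrow> nat \<Rightarrow> real set \<Rightarrow> real ^ 3 \<Rightarrow> (nat \<Rightarrow> real \<Rightarrow> complex ^ 3) \<Rightarrow>
   (nat \<Rightarrow> real \<Rightarrow> complex) \<Rightarrow> (real \<Rightarrow> real \<Rightarrow> real ^ 3) \<Rightarrow> bool" where
  "rational_solution \<sigma> N I m0 s x m \<longleftrightarrow>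
     is_interval I \<and> 0 \<in> I \<and>
     half_wave_maps \<sigma> I m \<and>
     m0 \<in> sphere 0 1 \<and>
     (\<forall>j\<in>{1..N}. smooth_on_interval I (s j) \<and> (\<forall>t\<in>I. s j t \<noteq> 0)) \<and>
     (\<forall>j\<in>{1..N}. smooth_on_interval I (x j) \<and> (\<forall>t\<in>I. Im (x j t) > 0)) \<and>
     (\<forall>t\<in>I. \<forall>j\<in>{1..N}. \<forall>k\<in>{1..N}. j \<noteq> k \<longrightarrow> x j t \<noteq> x k t) \<and>
     (\<forall>y. \<forall>t\<in>I. cvec (m y t) =
        cvec m0
        + \<i> *s (\<Sum>j\<in>{1..N}. (1 / (complex_of_real y - x j t)) *s s j t)
        - \<i> *s (\<Sum>j\<in>{1..N}. (1 / (complex_of_real y - cnj (x j t))) *s cnjv (s j t))) \<and>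
     (\<forall>j\<in>{1..N}. \<forall>t\<in>I.
        (s j has_vector_derivative
           (- 2) *s (\<Sum>k\<in>{1..N} - {j}. (1 / (x j t - x k t)\<^sup>2) *s ccross (s j t) (s k t)))
        (at t within I)) \<and>
     (\<forall>j\<in>{1..N}. \<forall>t\<in>I.
        ((\<lambda>\<tau>. vector_derivative (x j) (at \<tau> within I)) has_vector_derivative
           4 * (\<Sum>k\<in>{1..N} - {j}. cdot (s j t) (s k t) / (x j t - x k t) ^ 3))
        (at t within I)) \<and>
     (\<forall>j\<in>{1..N}.
        (x j has_vector_derivative
           cdot ((1 / cdot (s j 0) (cnjv (s j 0))) *s ccross (s j 0) (cnjv (s j 0)))
                (pole_field N m0 s x j 0))
        (at 0 within I))"

text \<open>The index set \<open>J\<close>: poles that come arbitrarily close to the real axis along some sequence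
  of times tending to infinity.\<close>

definition approaching_poles :: "nat \<Rightarrow> (nat \<Rightarrow> real \<Rightarrow> complex) \<Rightarrow> nat set" where
  "approaching_poles N x =
     {j \<in> {1..N}. \<exists>\<tau> :: nat \<Rightarrow> real. (\<forall>n. \<tau> n \<ge> 0) \<and> filterlim \<tau> at_top sequentially \<and>
        (\<lambda>n. Im (x j (\<tau> n))) \<longlonglongrightarrow> 0}"

end

theory Submission
  imports Defs "HOL-Complex_Analysis.Conformal_Mappings"
begin

text \<open>The first-order equation for the poles, imposed at \<open>t = 0\<close>, persists: its defect satisfies a
  homogeneous linear differential equation along the second-order dynamics. With \<open>n\<close> the normalised
  vector \<open>s j \<times> cnj (s j)\<close>, which is purely imaginary and orthogonal to \<open>s j\<close> and its conjugate, the velocity of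
  \<open>x j\<close> is the value at \<open>x j\<close> of the rational function \<open>h
      = i n \<cdot> m\<close>. This function is real and bounded
  on the real axis and has no poles at \<open>x j\<close> and its conjugate. If \<open>x j\<close> is close to the axis, separation keeps all other
  poles at distance at least \<open>\<eta>\<close> from the real part of \<open>x j\<close>; dividing out a Blaschke product and applying the maximum
  principle bounds \<open>h\<close> on a disc around this real part, so \<open>\<bar>Im (h (x j))\<bar>
      \<le> D Im (x j)\<close> by Cauchy's estimate, and
  \<open>Im (x j)\<close> decays at most exponentially.\<close>

subsection \<open>Bilinear dot and cross products\<close>

lemma cdot_3: "cdot u v = u $ 1 * v $ 1 + u $ 2 * v $ 2 + u $ 3 * v $ 3"
  by (simp add: cdot_def sum_3)

lemma ccross_nth:
  "ccross u v $ 1 = u $ 2 * v $ 3 - u $ 3 * v $ 2"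
  "ccross u v $ 2 = u $ 3 * v $ 1 - u $ 1 * v $ 3"
  "ccross u v $ 3 = u $ 1 * v $ 2 - u $ 2 * v $ 1"
  by (simp_all add: ccross_def)

text \<open>Bounded bilinearity, once interpreted below, gives the product rule for derivatives,
  distributivity over finite sums and norm bounds for each of the products.\<close>

lemma bounded_bilinear_cdot: "bounded_bilinear cdot"
  unfolding bilinear_conv_bounded_bilinear[symmetric] bilinear_def
  by (auto intro!: linearI simp: cdot_3 algebra_simps scaleR_conv_of_real[where 'a=complex])

lemma bounded_bilinear_ccross: "bounded_bilinear ccross"
  unfolding bilinear_conv_bounded_bilinear[symmetric] bilinear_def
  by (auto intro!: linearI
      simp: vec_eq_iff forall_3 ccross_nth algebra_simps scaleR_conv_of_real[where 'a=complex])

lemma bounded_bilinear_smult: "bounded_bilinear ((*s) :: complex \<Rightarrow> complex ^ 3 \<Rightarrow> complex ^ 3)"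
  unfolding bilinear_conv_bounded_bilinear[symmetric] bilinear_def
  by (auto intro!: linearI
      simp: vec_eq_iff algebra_simps scaleR_conv_of_real[where 'a=complex])

lemma bounded_linear_cnjv: "bounded_linear cnjv"
  unfolding linear_conv_bounded_linear[symmetric]
  by (auto intro!: linearI simp: vec_eq_iff cnjv_def)

interpretation cdot: bounded_bilinear cdot by (rule bounded_bilinear_cdot)
interpretation ccross: bounded_bilinear ccross by (rule bounded_bilinear_ccross)
interpretation csmult: bounded_bilinear "(*s) :: complex \<Rightarrow> complex ^ 3 \<Rightarrow> complex ^ 3"
  by (rule bounded_bilinear_smult)

lemma cdot_commute: "cdot u v = cdot v u"
  by (simp add: cdot_3 algebra_simps)

lemma cdot_smult [simp]: "cdot (c *s u) v = c * cdot u v" "cdot u (c *s v) = c * cdot u v"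
  by (simp_all add: cdot_3 algebra_simps)

lemma ccross_smult [simp]: "ccross (c *s u) v = c *s ccross u v" "ccross u (c *s v) = c *s ccross u v"
  by (simp_all add: vec_eq_iff forall_3 ccross_nth algebra_simps)

lemma ccross_triple_left: "ccross (ccross u v) w = cdot u w *s v - cdot v w *s u"
  by (simp add: vec_eq_iff forall_3 ccross_nth cdot_3 algebra_simps)

lemma ccross_triple_right: "ccross u (ccross v w) = cdot u w *s v - cdot u v *s w"
  by (simp add: vec_eq_iff forall_3 ccross_nth cdot_3 algebra_simps)

lemma cnjv_cdot: "cnj (cdot u v) = cdot (cnjv u) (cnjv v)"
  by (simp add: cdot_3 cnjv_def)

lemma cnjv_ccross: "cnjv (ccross u v) = ccross (cnjv u) (cnjv v)"
  by (simp add: vec_eq_iff forall_3 ccross_nth cnjv_def)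

lemma cdot_cnjv_self: "cdot s (cnjv s) = complex_of_real ((norm s)\<^sup>2)"
  by (simp add: cdot_3 cnjv_def norm_vec_def L2_set_def sum_3 complex_norm_square[symmetric])

text \<open>For \<open>s \<cdot> s = s \<cdot> b = 0\<close>, \<open>s \<times> b\<close> is annihilated
    by \<open>s \<times> _\<close>, hence parallel to \<open>s\<close>.\<close>

lemma isotropic_ccross:
  assumes "cdot s s = 0" "cdot s b = 0"
  shows "cdot s v *s ccross s b = - (cdot (ccross s v) b) *s s"
proof -
  have "ccross v (ccross s (ccross s b)) = 0"
    using assms by (simp add: ccross_triple_right[of s s] ccross.zero_right)
  hence "cdot v s *s ccross s b = cdot v (ccross s b) *s s"
    by (simp add: ccross_triple_right[of v])
  moreover have "cdot v (ccross s b) = - cdot (ccross s v) b"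
    by (simp add: cdot_3 ccross_nth algebra_simps)
  ultimately show ?thesis by (simp add: cdot_commute)
qed

subsection \<open>Persistence of the first-order equations\<close>

text \<open>For \<open>M = \<i> *s m0\<close> this is \<open>\<i>\<close> times the value at
  \<open>z p\<close> of the rational map \<open>m0 + i \<Sum> S q / (y - z q)\<close> with its own
  pole at \<open>z p\<close> removed.\<close>

definition bfield ::
  "'i set \<Rightarrow> complex ^ 3 \<Rightarrow> ('i \<Rightarrow> complex) \<Rightarrow> ('i \<Rightarrow> complex ^ 3) \<Rightarrow> 'i \<Rightarrow> complex ^ 3" where
  "bfield P M z S p = M - (\<Sum>q\<in>P - {p}. (1 / (z p - z q)) *s S q)"

text \<open>Interchanging the two summations turns the sum into its own negative.\<close>

lemma antisym_double_sum:
  fixes f :: "'i \<Rightarrow> 'i \<Rightarrow> 'a::real_vector"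
  assumes "finite Q" and "\<And>q l. q \<in> Q \<Longrightarrow> l \<in> Q
      \<Longrightarrow> q \<noteq> l \<Longrightarrow> f q l = - f l q"
  shows "(\<Sum>q\<in>Q. \<Sum>l\<in>Q - {q}. f q l) = 0"
proof -
  \<comment> \<open>Extending by zero on the diagonal makes both index sets equal to
    \<open>Q\<close>, so that the summations can be swapped.\<close>
  define g where "g q l = (if q = l then 0 else f q l)" for q l
  have anti: "g q l = - g l q" if "q \<in> Q" "l \<in> Q" for q l
    using assms(2)[OF that] by (simp add: g_def)
  have "(\<Sum>q\<in>Q. \<Sum>l\<in>Q. g q l) = (\<Sum>l\<in>Q. \<Sum>q\<in>Q. g q l)"
    by (rule sum.swap)
  also have "\<dots> = (\<Sum>l\<in>Q. \<Sum>q\<in>Q. - g l q)"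
    by (intro sum.cong refl anti)
  also have "\<dots> = - (\<Sum>q\<in>Q. \<Sum>l\<in>Q. g q l)"
    by (simp only: sum_negf)
  finally have "2 *\<^sub>R (\<Sum>q\<in>Q. \<Sum>l\<in>Q. g q l) = 0"
    unfolding scaleR_2 by (simp only: eq_neg_iff_add_eq_0)
  moreover have "(\<Sum>l\<in>Q - {q}. f q l) = (\<Sum>l\<in>Q. g q l)" if "q \<in> Q" for q
    using assms(1) by (intro sum.mono_neutral_cong_left) (auto simp: g_def)
  ultimately show ?thesis by simp
qed

text \<open>The constraints control \<open>S q\<close> only against its own field, so fields at
  different poles must be compared. Partial fractions merge the contributions of each third pole;
  the mutual contributions of \<open>p\<close> and \<open>q\<close> make up the last term.\<close>

lemma bfield_diff:
  assumes "finite P" "p \<in> P" "q \<in> P" "p \<noteq> q" "inj_on z P"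
  shows "bfield P M z S p - bfield P M z S q =
    (\<Sum>l\<in>P - {p} - {q}. ((z p - z q) / ((z q - z l) * (z p - z l))) *s S l)
    - (1 / (z p - z q)) *s (S p + S q)"
proof -
  let ?R = "P - {p} - {q}"
  have R: "(\<Sum>l\<in>P - {p}. g l) = g q + sum g ?R" "(\<Sum>l\<in>P - {q}. g l) = g p + sum g ?R"
    for g :: "'a \<Rightarrow> complex ^ 3"
  proof -
    show "(\<Sum>l\<in>P - {p}. g l) = g q + sum g ?R"
      using assms by (intro sum.remove) auto
    have "P - {q} - {p} = ?R" by auto
    thus "(\<Sum>l\<in>P - {q}. g l) = g p + sum g ?R"
      using assms sum.remove[of "P - {q}" p g] by auto
  qed
  have "(1 / (z q - z l)) *s S l - (1 / (z p - z l)) *s S l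
      = ((z p - z q) / ((z q - z l) * (z p - z l))) *s S l" if "l \<in> ?R" for l
  proof -
    have "z q - z l \<noteq> 0" "z p - z l \<noteq> 0"
      using that assms by (auto dest: inj_onD)
    hence "1 / (z q - z l) - 1 / (z p - z l) = (z p - z q) / ((z q - z l) * (z p - z l))"
      by (simp add: diff_frac_eq)
    thus ?thesis by (simp only: csmult.diff_left[symmetric])
  qed
  hence *: "(\<Sum>l\<in>?R. (1 / (z q - z l)) *s S l) - (\<Sum>l\<in>?R. (1 / (z p - z l)) *s S l)
      = (\<Sum>l\<in>?R. ((z p - z q) / ((z q - z l) * (z p - z l))) *s S l)"
    by (simp add: sum_subtractf[symmetric])
  have **: "1 / (z q - z p) = - (1 / (z p - z q))"
    by (metis divide_minus_right minus_diff_eq)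
  have "M - (c *s u + X) - (M - (- c *s v + Y)) = (Y - X) - c *s (v + u)"
    for c :: complex and u v X Y :: "complex ^ 3"
    by (simp add: vec_eq_iff algebra_simps)
  thus ?thesis
    unfolding bfield_def R ** *[symmetric] .
qed

text \<open>The defects \<open>E q\<close> of the first-order equations \<open>z' S = - r S \<times> b\<close> obey a homogeneous
  linear system. All terms without a defect collect into a double sum over pairs of poles
  whose summand is antisymmetric.\<close>

lemma defect_identity:
  fixes P :: "'i set" and z r zd :: "'i \<Rightarrow> complex" and S :: "'i \<Rightarrow> complex ^ 3" and M :: "complex ^ 3"
  defines "b \<equiv> bfield P M z S"
  defines "S' \<equiv> \<lambda>q. - (\<Sum>l\<in>P - {q}. ((r q + r l) / (z q - z l)\<^sup>2) *s ccross (S q) (S l))"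
  defines "E \<equiv> \<lambda>q. zd q *s S q + r q *s ccross (S q) (b q)"
  assumes fin: "finite P" and p: "p \<in> P" and inj: "inj_on z P" and r: "r p * r p = 1"
    and iso: "\<And>q. q \<in> P \<Longrightarrow> cdot (S q) (S q) = 0"
    and con: "\<And>q. q \<in> P \<Longrightarrow> cdot (S q) (b q) = 0"
  shows "(2 * (\<Sum>q\<in>P - {p}. (1 + r p * r q) * cdot (S p) (S q) / (z p - z q) ^ 3)) *s S p
      + zd p *s S' p
      + r p *s (ccross (S' p) (b p) + ccross (S p)
          (- (\<Sum>q\<in>P - {p}. (1 / (z p - z q)) *s S' q - ((zd p - zd q) / (z p - z q)\<^sup>2) *s S q)))
    = - (\<Sum>q\<in>P - {p}. (1 / (z p - z q)\<^sup>2) *s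
          (r q *s ccross (E p) (S q) + r p *s ccross (S p) (E q)))" (is "?L = ?R")
proof -
  define Q where "Q = P - {p}"
  define i where "i q l = 1 / (z q - z l)" for q l
  have finQ: "finite Q" using fin by (simp add: Q_def)
  have i_p2: "x / (z q - z l)\<^sup>2 = x * (i q l)\<^sup>2" and i_p3: "x / (z q - z l) ^ 3 = x * (i q l) ^ 3" for x q l
    by (simp_all add: i_def power_divide)
  have i_anti: "i q l = - i l q" for q l
    unfolding i_def by (metis divide_minus_right minus_diff_eq)
  define \<rho> where "\<rho> q = r p * r q" for q
  \<comment> \<open>The part of the difference of both sides that the pole \<open>q\<close>
    contributes. Once \<open>E\<close> is expanded, all terms with \<open>zd\<close> cancel in
    it.\<close>
  define t where "t q = (2 * (1 + \<rho> q) * cdot (S p) (S q) * (i p q) ^ 3) *s S p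
      - (zd p * (r p + r q) * (i p q)\<^sup>2) *s ccross (S p) (S q)
      - (r p * (r p + r q) * (i p q)\<^sup>2) *s ccross (ccross (S p) (S q)) (b p)
      - (r p * i p q) *s ccross (S p) (S' q)
      + (r p * (zd p - zd q) * (i p q)\<^sup>2) *s ccross (S p) (S q)
      + (i p q)\<^sup>2 *s (r q *s ccross (E p) (S q) + r p *s ccross (S p) (E q))" for q
  \<comment> \<open>What survives in \<open>t q\<close> is an interaction of three distinct poles
    \<open>p\<close>, \<open>q\<close>, \<open>l\<close>.\<close>
  define \<Phi> where "\<Phi> q l = (i p q * i p l * i q l * cdot (S q) (S l)) *s S p
      + (\<rho> q * (i p q * i p l * i q l)) *s (cdot (S p) (S q) *s S l - cdot (S p) (S l) *s S q)
      - ((\<rho> q + \<rho> l) * (i p q * (i q l)\<^sup>2)) *s (cdot (S p) (S q) *s S l - cdot (S p) (S l) *s S q)" for q l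
  have S'p: "S' p = - (\<Sum>q\<in>Q. ((r p + r q) * (i p q)\<^sup>2) *s ccross (S p) (S q))"
    by (simp add: S'_def Q_def i_p2)
  have "?L - ?R = (\<Sum>q\<in>Q. t q)"
    unfolding t_def Q_def[symmetric] S'p i_p2 i_p3 i_def[symmetric] \<rho>_def
by (simp add: csmult.sum_left csmult.sum_right ccross.sum_left ccross.sum_right ccross.diff_right
        ccross.minus_left ccross.minus_right csmult.minus_right csmult.diff_right csmult.add_right
        sum.distrib sum_subtractf sum_negf sum_distrib_left vec_eq_iff mult.assoc)
       (simp add: algebra_simps sum.distrib sum_subtractf)
  also have "t q = (\<Sum>l\<in>Q - {q}. \<Phi> q l)" if q: "q \<in> Q" for q
  proof -
    let ?T = "Q - {q}"
    define U where "U = (\<Sum>l\<in>?T. (i p q * i p l * i q l) *s S l)"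
    define V where "V = (\<Sum>l\<in>?T. ((\<rho> q + \<rho> l) * (i p q * (i q l)\<^sup>2)) *s
      (cdot (S p) (S q) *s S l - cdot (S p) (S l) *s S q))"
    define pq where "pq = cdot (S p) (S q)"
    have qP: "q \<in> P" "p \<noteq> q" using q by (auto simp: Q_def)
    have ne: "z p - z q \<noteq> 0" using qP p inj by (auto dest: inj_onD)
    have PT: "P - {q} = insert p ?T" "finite ?T" "p \<notin> ?T"
      using qP p fin by (auto simp: Q_def)
    have \<Phi>: "(\<Sum>l\<in>?T. \<Phi> q l)
        = cdot (S q) U *s S p + \<rho> q *s (pq *s U - cdot (S p) U *s S q) - V"
      unfolding \<Phi>_def U_def V_def pq_def
      by (simp add: sum.distrib sum_subtractf csmult.sum_left[symmetric] csmult.sum_right cdot.sum_right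
          csmult.diff_right sum_distrib_left mult_ac)
    have "b p - b q = (\<Sum>l\<in>?T. ((z p - z q) * (i p l * i q l)) *s S l) - i p q *s (S p + S q)"
      using bfield_diff[OF fin p qP(1) qP(2) inj, of M S] unfolding b_def i_def Q_def by (simp add: mult.commute)
    moreover have "(i p q)\<^sup>2 * ((z p - z q) * (i p l * i q l)) = i p q * i p l * i q l" for l
      using ne by (simp add: i_def power2_eq_square)
    \<comment> \<open>The factor \<open>(i p q)\<^sup>2\<close> turns the coefficients of
      \<open>bfield_diff\<close> into the products \<open>i p q * i p l * i q l\<close> that occur
      in \<Phi>.\<close>
    ultimately have bU: "(i p q)\<^sup>2 *s (b p - b q) = U - (i p q) ^ 3 *s (S p + S q)"
      unfolding U_def
      by (simp only: csmult.sum_right csmult.diff_right vector_smult_assoc) (simp add: power2_eq_square power3_eq_cube mult.assoc)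
    have pq: "cdot (S q) (S p) = pq" "cdot (S p) (S q) = pq" by (simp_all add: pq_def cdot_commute)
    \<comment> \<open>Pairing \<open>bU\<close> with \<open>S q\<close> removes \<open>b q\<close>
      by the constraint and \<open>S q\<close> by isotropy; \<open>pb\<close> does the same with the
      roles of \<open>p\<close> and \<open>q\<close> exchanged.\<close>
    have qb: "(i p q)\<^sup>2 * cdot (S q) (b p) = cdot (S q) U - (i p q) ^ 3 * pq"
    proof -
      have "cdot (S q) ((i p q)\<^sup>2 *s (b p - b q)) = cdot (S q) (U - (i p q) ^ 3 *s (S p + S q))"
        by (simp only: bU)
      thus ?thesis using iso[OF qP(1)] con[OF qP(1)]
        by (simp add: cdot.diff_right cdot.add_right pq)
    qed
    have pb: "(i p q)\<^sup>2 * cdot (S p) (b q) = - cdot (S p) U + (i p q) ^ 3 * pq"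
    proof -
      have "cdot (S p) ((i p q)\<^sup>2 *s (b p - b q)) = cdot (S p) (U - (i p q) ^ 3 *s (S p + S q))"
        by (simp only: bU)
      thus ?thesis using iso[OF p] con[OF p]
        by (simp add: cdot.diff_right cdot.add_right pq) algebra
    qed
    have "S' q = - ((r p + r q) * (i p q)\<^sup>2) *s ccross (S q) (S p)
        - (\<Sum>l\<in>?T. ((r q + r l) * (i q l)\<^sup>2) *s ccross (S q) (S l))"
      unfolding S'_def PT(1) sum.insert[OF PT(2,3)] i_p2 i_anti[of q p]
      by (simp add: vec_eq_iff algebra_simps)
    \<comment> \<open>In \<open>S' q\<close> the summand of \<open>p\<close> is separated from those
      of third poles; the triple product then needs only \<open>cdot (S p) (S p) = 0\<close> and
      \<open>r p * r p = 1\<close>.\<close>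
    hence V: "(r p * i p q) *s ccross (S p) (S' q) = ((1 + \<rho> q) * (i p q) ^ 3 * pq) *s S p + V"
      proof -
      assume S'q: "S' q = - ((r p + r q) * (i p q)\<^sup>2) *s ccross (S q) (S p)
        - (\<Sum>l\<in>?T. ((r q + r l) * (i q l)\<^sup>2) *s ccross (S q) (S l))"
      have "(r p * i p q) *s (\<Sum>l\<in>?T. ((r q + r l) * (i q l)\<^sup>2) *s
          (cdot (S p) (S l) *s S q - pq *s S l)) = - V"
        unfolding V_def csmult.sum_right sum_negf[symmetric] pq_def[symmetric] \<rho>_def
        by (intro sum.cong refl) (simp add: vec_eq_iff algebra_simps)
      moreover have "r p * i p q * ((r p + r q) * (i p q)\<^sup>2 * pq) = (1 + \<rho> q) * (i p q) ^ 3 * pq"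
        unfolding \<rho>_def using r by algebra
      moreover have "ccross (S p) (S' q) = ((r p + r q) * (i p q)\<^sup>2) *s (pq *s S p)
          - (\<Sum>l\<in>?T. ((r q + r l) * (i q l)\<^sup>2) *s (cdot (S p) (S l) *s S q - pq *s S l))"
        unfolding S'q ccross.diff_right ccross_smult ccross.sum_right ccross_triple_right iso[OF p] pq
        by (simp add: vec_eq_iff)
      ultimately show ?thesis
        by (simp only: csmult.diff_right vector_smult_assoc) (simp only: diff_minus_eq_add)
    qed
    have "t q = cdot (S q) U *s S p + \<rho> q *s (pq *s U - cdot (S p) U *s S q) - V"
    proof -
      have "t q $ k = (cdot (S q) U *s S p + \<rho> q *s (pq *s U - cdot (S p) U *s S q) - V) $ k" for k
      proof -
        have 1: "(i p q)\<^sup>2 * (b p $ k - b q $ k) = U $ k - (i p q) ^ 3 * (S p $ k + S q $ k)"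
          using arg_cong[OF bU, of "\<lambda>v. v $ k"] by (simp add: algebra_simps)
        have 2: "r p * i p q * ccross (S p) (S' q) $ k = (1 + \<rho> q) * (i p q) ^ 3 * pq * S p $ k + V $ k"
          using arg_cong[OF V, of "\<lambda>v. v $ k"] by (simp add: algebra_simps)
        show ?thesis
          \<comment> \<open>Triple products reduce everything to scalar multiples of spins and
            fields; the four identities \<open>1\<close>, \<open>2\<close>, \<open>qb\<close>,
            \<open>pb\<close> then eliminate the fields.\<close>
          unfolding t_def E_def ccross.add_left ccross.add_right ccross_smult ccross_triple_left
            ccross_triple_right pq con[OF p] cdot_commute[of "b p" "S q"] \<rho>_def
          using 1 2 qb pb r unfolding \<rho>_def
          by simp algebra
      qed
      thus ?thesis by (simp add: vec_eq_iff)
    qed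
    thus ?thesis by (simp add: \<Phi>)
  qed
  hence "(\<Sum>q\<in>Q. t q) = (\<Sum>q\<in>Q. \<Sum>l\<in>Q - {q}. \<Phi> q l)" by simp
  also have "\<dots> = 0"
  proof (rule antisym_double_sum[OF finQ])
    fix q l assume "q \<in> Q" "l \<in> Q" "q \<noteq> l"
    hence ne: "z p - z q \<noteq> 0" "z p - z l \<noteq> 0" "z q - z l \<noteq> 0"
      using inj p by (auto simp: Q_def dest: inj_onD)
    \<comment> \<open>Partial fractions: \<open>z p - z l\<close> is the sum of
      \<open>z p - z q\<close> and \<open>z q - z l\<close>.\<close>
    have key: "i p q * i q l = i p l * i q l + i p q * i p l"
      using ne by (simp add: i_def divide_simps) 
    have "i p q * (i q l)\<^sup>2 - i p l * (i q l)\<^sup>2 = i p q * i p l * i q l"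
      using key by (simp add: power2_eq_square) algebra
    thus "\<Phi> q l = - \<Phi> l q"
      unfolding \<Phi>_def i_anti[of l q] cdot_commute[of "S l" "S q"]
      by (simp add: vec_eq_iff) algebra
  qed
  finally show ?thesis by (rule right_minus_eq[THEN iffD1])
qed

section \<open>Gronwall estimate and propagation in time\<close>

lemma norm_smult_cvec: "norm (c *s v) = cmod c * norm (v :: complex ^ 3)"
  by (simp add: norm_vec_def norm_mult L2_set_right_distrib)

lemma has_vector_derivative_inverse:
  fixes f :: "real \<Rightarrow> complex"
  assumes "(f has_vector_derivative f') (at t within A)" "f t \<noteq> 0"
  shows "((\<lambda>t. 1 / f t) has_vector_derivative - f' / (f t)\<^sup>2) (at t within A)"
proof -
  have "((\<lambda>z. 1 / z) has_field_derivative - (1 / (f t)\<^sup>2)) (at (f t) within f ` A)"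
    using assms(2) by (auto intro!: derivative_eq_intros simp: power2_eq_square)
  from field_vector_diff_chain_within[OF assms(1) this] show ?thesis
    by (simp add: o_def)
qed

text \<open>The energy, the sum of the squared norms, satisfies \<phi>' \<le> K \<phi>, so \<phi>
  times \<open>exp (- K * s)\<close> cannot grow from its initial value 0.\<close>

lemma gronwall_zero:
  fixes E E' :: "'i \<Rightarrow> real \<Rightarrow> 'a::real_inner"
  assumes fin: "finite P"
    and der: "\<And>p t. p \<in> P \<Longrightarrow> t \<in> {0..T} \<Longrightarrow>
      (E p has_vector_derivative E' p t) (at t within {0..T})"
    and bnd: "\<And>p t. p \<in> P \<Longrightarrow> t \<in> {0..T}
        \<Longrightarrow> norm (E' p t) \<le> C * (\<Sum>q\<in>P. norm (E q t))"
    and init: "\<And>p. p \<in> P \<Longrightarrow> E p 0 = 0"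
    and p: "p \<in> P" and t: "t \<in> {0..T}"
  shows "E p t = 0"
proof (cases "t = 0")
  case True
  thus ?thesis using init p by simp
next
  case False
  hence t0: "0 < t" using t by simp
  \<comment> \<open>The 2 comes from differentiating a square, \<open>card P\<close> from the
    Cauchy-Schwarz inequality between the squared sum of norms and the sum of squared norms.\<close>
  define K where "K = 2 * \<bar>C\<bar> * card P"
  define \<phi> where "\<phi> s = (\<Sum>p\<in>P. E p s \<bullet> E p s)" for s
  define \<phi>' where "\<phi>' s = (\<Sum>p\<in>P. E p s \<bullet> E' p s + E' p s \<bullet> E p s)" for s
  have d\<phi>: "(\<phi> has_real_derivative \<phi>' s) (at s within {0..T})" if "s \<in> {0..T}" for s
    unfolding has_real_derivative_iff_has_vector_derivative \<phi>_def \<phi>'_def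
    by (intro has_vector_derivative_sum bounded_bilinear.has_vector_derivative[OF bounded_bilinear_inner]
        der that)
  have \<phi>'_le: "\<phi>' s \<le> K * \<phi> s" if s: "s \<in> {0..T}" for s
  proof -
    define N where "N = (\<Sum>q\<in>P. norm (E q s))"
    have "\<phi>' s \<le> (\<Sum>p\<in>P. 2 * (norm (E p s) * (\<bar>C\<bar> * N)))"
      unfolding \<phi>'_def
    proof (rule sum_mono)
      fix p assume p: "p \<in> P"
      have "norm (E' p s) \<le> C * N" using bnd[OF p s] by (simp add: N_def)
      also have "\<dots> \<le> \<bar>C\<bar> * N" by (intro mult_right_mono) (auto simp: N_def intro: sum_nonneg)
      finally have "norm (E p s) * norm (E' p s) \<le> norm (E p s) * (\<bar>C\<bar> * N)"
        by (intro mult_left_mono) auto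
      moreover have "E p s \<bullet> E' p s \<le> norm (E p s) * norm (E' p s)"
        by (rule norm_cauchy_schwarz)
      ultimately show "E p s \<bullet> E' p s + E' p s \<bullet> E p s \<le> 2 * (norm (E p s) * (\<bar>C\<bar> * N))"
        by (simp add: inner_commute)
    qed
    also have "\<dots> = 2 * \<bar>C\<bar> * N\<^sup>2"
      by (simp add: N_def sum_distrib_left[symmetric] sum_distrib_right[symmetric] power2_eq_square)
    also have "N\<^sup>2 \<le> card P * \<phi> s"
      using sum_squared_le_sum_of_squares[of "\<lambda>q. norm (E q s)" P]
      by (simp add: N_def \<phi>_def power2_norm_eq_inner mult.commute)
    finally show ?thesis
      by (simp add: K_def mult_left_mono mult.assoc)
  qed
  let ?g = "\<lambda>s. \<phi> s * exp (- K * s)"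
  have "?g 0 \<ge> ?g t"
  proof (rule DERIV_nonpos_imp_decreasing_open[OF t0[THEN less_imp_le]])
    fix s assume s: "0 < s" "s < t"
    hence sT: "s \<in> {0..T}" "s \<in> interior {0..T}" using t by (auto simp: interior_atLeastAtMost_real)
    have "(\<phi> has_real_derivative \<phi>' s) (at s)"
      using d\<phi>[OF sT(1)] at_within_interior[OF sT(2)] by simp
    hence "(?g has_real_derivative (\<phi>' s - K * \<phi> s) * exp (- K * s)) (at s)"
      by (auto intro!: derivative_eq_intros simp: algebra_simps)
    moreover have "(\<phi>' s - K * \<phi> s) * exp (- K * s) \<le> 0"
      using \<phi>'_le[OF sT(1)] by (simp add: mult_nonpos_nonneg)
    ultimately show "\<exists>y. (?g has_real_derivative y) (at s) \<and> y \<le> 0" by blast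
  next
    have "continuous_on {0..T} \<phi>"
      using d\<phi> by (meson DERIV_continuous continuous_on_eq_continuous_within)
    hence "continuous_on {0..t} \<phi>" by (rule continuous_on_subset) (use t in auto)
    thus "continuous_on {0..t} ?g" by (intro continuous_intros)
  qed
  moreover have "?g 0 = 0" using init by (simp add: \<phi>_def)
  ultimately have "\<phi> t \<le> 0" by (simp add: mult_le_0_iff)
  hence "(\<Sum>p\<in>P. E p t \<bullet> E p t) = 0"
    by (intro antisym sum_nonneg) (auto simp: \<phi>_def)
  thus ?thesis using fin p by (simp add: sum_nonneg_eq_0_iff)
qed

text \<open>By \<open>defect_identity\<close> the defects solve a homogeneous linear system with
  coefficients bounded on compact time intervals, so Gronwall applies. The signs \<open>r\<close>
  distinguish poles from conjugate poles: \<open>1 + r p * r q\<close> and \<open>r p + r q\<close>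
  vanish for opposite signs, which decouples the two families in the dynamics while both enter the
  field.\<close>

lemma first_order_propagates:
  fixes P :: "'i set" and r :: "'i \<Rightarrow> complex" and z zd :: "'i \<Rightarrow> real \<Rightarrow> complex"
    and S :: "'i \<Rightarrow> real \<Rightarrow> complex ^ 3" and M :: "complex ^ 3"
  defines "b \<equiv> \<lambda>p t. bfield P M (\<lambda>q. z q t) (\<lambda>q. S q t) p"
  assumes fin: "finite P" and r: "\<And>p. p \<in> P \<Longrightarrow> r p * r p = 1"
    and inj: "\<And>t. t \<ge> 0 \<Longrightarrow> inj_on (\<lambda>q. z q t) P"
    and iso: "\<And>p t. p \<in> P \<Longrightarrow> t \<ge> 0 \<Longrightarrow> cdot (S p t) (S p t) = 0"
    and con: "\<And>p t. p \<in> P \<Longrightarrow> t \<ge> 0 \<Longrightarrow> cdot (S p t) (b p t) = 0"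
    and dz: "\<And>p t. p \<in> P \<Longrightarrow> t \<ge> 0
        \<Longrightarrow> (z p has_vector_derivative zd p t) (at t within {0..})"
    and dzd: "\<And>p t. p \<in> P \<Longrightarrow> t \<ge> 0 \<Longrightarrow> (zd p has_vector_derivative
        2 * (\<Sum>q\<in>P - {p}. (1 + r p * r q) * cdot (S p t) (S q t) / (z p t - z q t) ^ 3))
        (at t within {0..})"
    and dS: "\<And>p t. p \<in> P \<Longrightarrow> t \<ge> 0 \<Longrightarrow> (S p has_vector_derivative
        - (\<Sum>q\<in>P - {p}. ((r p + r q) / (z p t - z q t)\<^sup>2) *s ccross (S p t) (S q t)))
        (at t within {0..})"
    and init: "\<And>p. p \<in> P \<Longrightarrow> zd p 0 *s S p 0 + r p *s ccross (S p 0) (b p 0) = 0"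
    and p: "p \<in> P" and t: "t \<ge> 0"
  shows "zd p t *s S p t + r p *s ccross (S p t) (b p t) = 0"
proof -
  define E where "E p t = zd p t *s S p t + r p *s ccross (S p t) (b p t)" for p t
  define E' where "E' p t = - (\<Sum>q\<in>P - {p}. (1 / (z p t - z q t)\<^sup>2) *s
          (r q *s ccross (E p t) (S q t) + r p *s ccross (S p t) (E q t)))" for p t
  have ne: "z p t - z q t \<noteq> 0" if "p \<in> P" "q \<in> P - {p}" "t \<ge> 0" for p q t
    using inj[OF that(3)] that by (auto dest: inj_onD)
  have dE: "(E p has_vector_derivative E' p t) (at t within {0..})" if pt: "p \<in> P" "t \<ge> 0" for p t
  proof -
    define S' where "S' p = - (\<Sum>q\<in>P - {p}. ((r p + r q) / (z p t - z q t)\<^sup>2) *s ccross (S p t) (S q t))" for p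
    define b' where "b' = - (\<Sum>q\<in>P - {p}. (1 / (z p t - z q t)) *s S' q
        - ((zd p t - zd q t) / (z p t - z q t)\<^sup>2) *s S q t)"
    have dS': "(S q has_vector_derivative S' q) (at t within {0..})" if "q \<in> P" for q
      unfolding S'_def by (rule dS[OF that pt(2)])
    have "((\<lambda>t. (1 / (z p t - z q t)) *s S q t) has_vector_derivative
        (1 / (z p t - z q t)) *s S' q + (- (zd p t - zd q t) / (z p t - z q t)\<^sup>2) *s S q t) (at t within {0..})"
      if "q \<in> P - {p}" for q
      using that pt
      by (intro csmult.has_vector_derivative has_vector_derivative_inverse has_vector_derivative_diff
          dz dS' ne) auto
    hence "(b p has_vector_derivative (0 - (\<Sum>q\<in>P - {p}. (1 / (z p t - z q t)) *s S' q
        + (- (zd p t - zd q t) / (z p t - z q t)\<^sup>2) *s S q t))) (at t within {0..})"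
      unfolding b_def bfield_def
      by (intro has_vector_derivative_diff has_vector_derivative_const has_vector_derivative_sum)
    moreover have "(0 - (\<Sum>q\<in>P - {p}. (1 / (z p t - z q t)) *s S' q
        + (- (zd p t - zd q t) / (z p t - z q t)\<^sup>2) *s S q t)) = b'"
      unfolding b'_def minus_divide_left[symmetric] csmult.minus_left by simp
    ultimately have db: "(b p has_vector_derivative b') (at t within {0..})" by simp
    have "(E p has_vector_derivative
        (zd p t *s S' p + (2 * (\<Sum>q\<in>P - {p}. (1 + r p * r q) * cdot (S p t) (S q t) / (z p t - z q t) ^ 3)) *s S p t)
        + r p *s (ccross (S p t) b' + ccross (S' p) (b p t))) (at t within {0..})"
      unfolding E_def[abs_def]
      by (intro has_vector_derivative_add csmult.has_vector_derivative dzd pt dS' 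
          bounded_linear.has_vector_derivative[OF csmult.bounded_linear_right]
          ccross.has_vector_derivative db)
    moreover have "(2 * (\<Sum>q\<in>P - {p}. (1 + r p * r q) * cdot (S p t) (S q t) / (z p t - z q t) ^ 3)) *s S p t
        + zd p t *s S' p + r p *s (ccross (S' p) (b p t) + ccross (S p t) b') = E' p t"
      unfolding E'_def E_def b'_def S'_def b_def
      by (rule defect_identity[where z = "\<lambda>q. z q t" and zd = "\<lambda>q. zd q t"
          and S = "\<lambda>q. S q t" and r = r and p = p,
            OF fin pt(1) inj[OF pt(2)] r[OF pt(1)]])
         (use iso con pt in \<open>auto simp: b_def\<close>)
    ultimately show ?thesis by (simp add: add_ac)
  qed
  obtain Kc where Kc: "0 \<le> Kc" "\<And>u v. norm (ccross u v) \<le> norm u * norm v * Kc"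
    using ccross.nonneg_bounded by blast
  \<comment> \<open>Size of the coefficients of the linear system. It is continuous because the
    poles never collide, hence bounded on \<open>{0..t}\<close>.\<close>
  define g where "g p s = (\<Sum>q\<in>P - {p}. cmod (1 / (z p s - z q s)\<^sup>2) *
      (cmod (r q) * norm (S q s) + cmod (r p) * norm (S p s)))" for p s
  define G where "G s = (\<Sum>p\<in>P. g p s)" for s
  have "continuous_on {0..} (z p)" "continuous_on {0..} (S p)" if "p \<in> P" for p
    using dz[OF that] dS[OF that]
    by (auto simp: continuous_on_eq_continuous_within intro!: has_vector_derivative_continuous)
  hence "continuous_on {0..t} (z p)" "continuous_on {0..t} (S p)" if "p \<in> P" for p
    using that by (meson atLeastAtMost_subseteq_atLeastLessThan_iff continuous_on_subset Icc_subset_Ici_iff order_refl)+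
  hence "continuous_on {0..t} G"
    unfolding G_def g_def using ne by (intro continuous_intros) (auto simp: dest!: ne)
  hence "bounded (G ` {0..t})" by (intro compact_imp_bounded compact_continuous_image) auto
  then obtain L where L: "\<And>s. s \<in> {0..t} \<Longrightarrow> G s \<le> L"
    unfolding bounded_iff by (metis abs_le_D1 imageI real_norm_def)
  have "E p t = 0"
  proof (rule gronwall_zero[OF fin, where T = t and C = "Kc * L" and E' = E'])
    fix p s assume ps: "p \<in> P" "s \<in> {0..t}"
    show "(E p has_vector_derivative E' p s) (at s within {0..t})"
      by (rule has_vector_derivative_within_subset[OF dE]) (use ps in auto)
    define N where "N = (\<Sum>q\<in>P. norm (E q s))"
    have N: "norm (E q s) \<le> N" if "q \<in> P" for q
      unfolding N_def using fin that by (intro member_le_sum) auto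
    have N0: "0 \<le> N" by (auto simp: N_def intro: sum_nonneg)
    have "norm (E' p s) \<le> (\<Sum>q\<in>P - {p}. cmod (1 / (z p s - z q s)\<^sup>2) *
        (cmod (r q) * norm (S q s) + cmod (r p) * norm (S p s)) * (Kc * N))"
      unfolding E'_def norm_minus_cancel
    proof (rule sum_norm_le)
      fix q assume q: "q \<in> P - {p}"
      have "norm (r q *s ccross (E p s) (S q s) + r p *s ccross (S p s) (E q s))
          \<le> cmod (r q) * norm (ccross (E p s) (S q s)) + cmod (r p) * norm (ccross (S p s) (E q s))"
        by (rule order_trans[OF norm_triangle_ineq]) (simp add: norm_smult_cvec)
      also have "\<dots> \<le> cmod (r q) * (N * norm (S q s) * Kc) + cmod (r p) * (norm (S p s) * N * Kc)"
        using N[of q] N[of p] q ps Kc(1)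
        by (intro add_mono mult_left_mono order_trans[OF Kc(2)] mult_right_mono) auto
      also have "\<dots> = (cmod (r q) * norm (S q s) + cmod (r p) * norm (S p s)) * (Kc * N)"
        by (simp add: algebra_simps)
      finally show "norm ((1 / (z p s - z q s)\<^sup>2) *s (r q *s ccross (E p s) (S q s) + r p *s ccross (S p s) (E q s)))
        \<le> cmod (1 / (z p s - z q s)\<^sup>2) *
        (cmod (r q) * norm (S q s) + cmod (r p) * norm (S p s)) * (Kc * N)"
        unfolding norm_smult_cvec mult.assoc by (intro mult_left_mono) auto
    qed
    also have "\<dots> = g p s * (Kc * N)"
      by (simp only: g_def sum_distrib_right)
    also have "\<dots> \<le> G s * (Kc * N)"
      unfolding G_def using fin ps Kc(1) N0
      by (intro mult_right_mono member_le_sum[where i = p and f = "\<lambda>p. g p s"])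
         (auto simp: g_def intro!: sum_nonneg)
    also have "\<dots> \<le> L * (Kc * N)"
      using L ps Kc(1) N0 by (intro mult_right_mono) auto
    finally show "norm (E' p s) \<le> Kc * L * (\<Sum>q\<in>P. norm (E q s))"
      by (simp add: N_def mult_ac)
  qed (use p t init in \<open>auto simp: E_def\<close>)
  thus ?thesis by (simp add: E_def)
qed

subsection \<open>Constraints from the unit sphere\<close>

lemma cvec_unit_sphere:
  assumes "v \<in> sphere 0 1"
  shows "cdot (cvec v) (cvec v) = 1"
proof -
  have "(\<Sum>i\<in>UNIV. v $ i * v $ i) = 1"
    using assms by (simp add: norm_eq_sqrt_inner inner_vec_def)
  hence "complex_of_real (\<Sum>i\<in>UNIV. v $ i * v $ i) = 1" by simp
  thus ?thesis by (simp add: cdot_def cvec_def)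
qed

text \<open>With \<open>F z = m z\<close> minus its pole at \<open>z p\<close>, the identity \<open>m \<cdot> m
    = 1\<close> extends from the real axis
  to \<open>- S p \<cdot> S p + 2 i (z - z p) S p \<cdot> F z
      + (z - z p)\<^sup>2 (F z \<cdot> F z - 1) = 0\<close>; the constraints are its first
  two Taylor coefficients at \<open>z p\<close>.\<close>

lemma unit_sphere_constraints:
  fixes P :: "'i set" and z :: "'i \<Rightarrow> complex" and S :: "'i \<Rightarrow> complex ^ 3" and M :: "complex ^ 3"
  assumes fin: "finite P" and p: "p \<in> P" and inj: "inj_on z P"
    and nonreal: "\<And>q. q \<in> P \<Longrightarrow> Im (z q) \<noteq> 0"
    and unit: "\<And>y::real. cdot (M + \<i> *s (\<Sum>q\<in>P. (1 / (of_real y - z q)) *s S q))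
                             (M + \<i> *s (\<Sum>q\<in>P. (1 / (of_real y - z q)) *s S q)) = 1"
  shows "cdot (S p) (S p) = 0" and "cdot (S p) (bfield P (\<i> *s M) z S p) = 0"
proof -
  define Q where "Q = P - {p}"
  define F where "F \<zeta> = M + \<i> *s (\<Sum>q\<in>Q. (1 / (\<zeta> - z q)) *s S q)" for \<zeta>
  \<comment> \<open>The plane without the other poles: a connected open set containing the real axis
    and \<open>z p\<close>.\<close>
  define U where "U = UNIV - z ` Q"
  have finQ: "finite Q" using fin by (simp add: Q_def)
  have U: "open U" "connected U"
    unfolding U_def using finQ
    by (auto intro!: open_delete finite_imp_closed open_Diff connected_open_delete_finite)
  have pU: "z p \<in> U" using inj p by (auto simp: U_def Q_def dest: inj_onD)
  have realU: "of_real y \<in> U" for y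
    using nonreal by (auto simp: U_def Q_def) (metis Im_complex_of_real)
  have holF: "(\<lambda>\<zeta>. F \<zeta> $ k) holomorphic_on U" for k
    unfolding F_def U_def by (auto intro!: holomorphic_intros)
  have hol: "(\<lambda>\<zeta>. cdot (F \<zeta>) (F \<zeta>)) holomorphic_on U" "(\<lambda>\<zeta>. cdot (S p) (F \<zeta>)) holomorphic_on U"
    unfolding cdot_3 by (intro holomorphic_intros holF)+
  \<comment> \<open>Identity theorem: the real axis has the limit point 0 in
    \<open>U\<close>.\<close>
  have vanish: "f \<zeta> = 0" if "f holomorphic_on U" "\<And>y::real. f (of_real y) = 0" "\<zeta> \<in> U"
      for f :: "complex \<Rightarrow> complex" and \<zeta>
  proof (rule analytic_continuation[OF that(1) U, where U = "range complex_of_real" and \<xi> = 0])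
    have "\<exists>w\<in>range complex_of_real. w \<noteq> 0 \<and> dist w 0 < e" if "e > 0" for e
      using that by (intro bexI[of _ "of_real (e / 2)"]) (auto simp del: of_real_divide)
    thus "0 islimpt range complex_of_real"
      by (simp add: islimpt_approachable)
  qed (use that realU realU[of 0] in auto)
  have eq: "- cdot (S p) (S p) + 2 * \<i> * (of_real y - z p) * cdot (S p) (F (of_real y))
      + (of_real y - z p)\<^sup>2 * (cdot (F (of_real y)) (F (of_real y)) - 1) = 0" for y :: real
  proof -
    define c where "c = of_real y - z p"
    have c: "c \<noteq> 0" using nonreal[OF p] by (auto simp: c_def complex_eq_iff)
    have "P = insert p Q" "p \<notin> Q" using p by (auto simp: Q_def)
    hence "M + \<i> *s (\<Sum>q\<in>P. (1 / (of_real y - z q)) *s S q) = (\<i> / c) *s S p + F (of_real y)"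
      using finQ by (simp add: F_def c_def vec_eq_iff algebra_simps)
    hence "cdot ((\<i> / c) *s S p + F (of_real y)) ((\<i> / c) *s S p + F (of_real y)) = 1"
      using unit[of y] by simp
    hence "(\<i> / c)\<^sup>2 * cdot (S p) (S p) + 2 * (\<i> / c) * cdot (S p) (F (of_real y))
        + cdot (F (of_real y)) (F (of_real y)) = 1"
      by (simp add: cdot.add_left cdot.add_right cdot_commute[of "F _" "S p"] power2_eq_square algebra_simps)
    moreover have "(\<i> / c) * c = \<i>" "\<i> * \<i> = -1" using c by auto
    ultimately show ?thesis unfolding c_def[symmetric] by algebra
  qed
  have "- cdot (S p) (S p) + 2 * \<i> * (z p - z p) * cdot (S p) (F (z p))
      + (z p - z p)\<^sup>2 * (cdot (F (z p)) (F (z p)) - 1) = 0"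
    by (rule vanish[where \<zeta> = "z p" and f = "\<lambda>\<zeta>. - cdot (S p) (S p)
        + 2 * \<i> * (\<zeta> - z p) * cdot (S p) (F \<zeta>)
      + (\<zeta> - z p)\<^sup>2 * (cdot (F \<zeta>) (F \<zeta>) - 1)", OF _ eq pU]) (intro holomorphic_intros hol)
  thus iso: "cdot (S p) (S p) = 0" by simp
  \<comment> \<open>With the constant term gone, a factor \<open>of_real y - z p\<close>, nonzero on
    the real axis, can be divided out before evaluating at \<open>z p\<close>.\<close>
  have "2 * \<i> * cdot (S p) (F (of_real y)) + (of_real y - z p) * (cdot (F (of_real y)) (F (of_real y)) - 1) = 0" for y :: real
  proof -
    have "of_real y - z p \<noteq> 0" using nonreal[OF p] by (auto simp: complex_eq_iff)
    thus ?thesis using eq[of y] iso by algebra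
  qed
  hence "2 * \<i> * cdot (S p) (F (z p)) + (z p - z p) * (cdot (F (z p)) (F (z p)) - 1) = 0"
    by (intro vanish[where \<zeta> = "z p" and f = "\<lambda>\<zeta>. 2 * \<i> * cdot (S p) (F \<zeta>)
      + (\<zeta> - z p) * (cdot (F \<zeta>) (F \<zeta>) - 1)", OF _ _ pU]) (intro holomorphic_intros hol)
  hence "cdot (S p) (F (z p)) = 0" by simp
  moreover have "bfield P (\<i> *s M) z S p = \<i> *s F (z p)"
    unfolding bfield_def F_def Q_def
    by (simp add: vec_eq_iff algebra_simps)
  ultimately show "cdot (S p) (bfield P (\<i> *s M) z S p) = 0" by simp
qed

subsection \<open>Rational functions bounded on the real axis\<close>

text \<open>Maximum modulus on a large half disc. The diameter is covered by the bound on the real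
  axis, the arc by the limit at infinity.\<close>

lemma half_plane_maximum_principle:
  assumes hol: "f holomorphic_on U" and U: "open U" "{z. Im z \<ge> 0} \<subseteq> U"
    and lim: "(f \<longlongrightarrow> L) at_infinity"
    and real: "\<And>y::real. cmod (f (of_real y)) \<le> K"
    and z: "Im z \<ge> 0"
  shows "cmod (f z) \<le> K"
proof (rule field_le_epsilon)
  fix e :: real assume "e > 0"
  hence "\<forall>\<^sub>F w in at_infinity. dist (f w) L < e / 2"
    using lim by (intro tendstoD) auto
  then obtain R where R: "\<And>w. norm w \<ge> R \<Longrightarrow> dist (f w) L < e / 2"
    unfolding eventually_at_infinity by blast
  define R' where "R' = max R (cmod z) + 1"
  define S where "S = {w. Im w \<ge> 0} \<inter> cball 0 R'"
  have R': "R' \<ge> R" "R' > cmod z" by (auto simp: R'_def)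
  have R'0: "R' > 0" using R'(2) norm_ge_zero[of z] by linarith
  have clS: "closed S" unfolding S_def by (intro closed_Int closed_halfspace_Im_ge) auto
  have SU: "S \<subseteq> U" using U by (auto simp: S_def)
  show "cmod (f z) \<le> K + e"
  proof (rule maximum_modulus_frontier[of f S])
    show "f holomorphic_on interior S"
      by (rule holomorphic_on_subset[OF hol]) (use SU interior_subset in blast)
    show "continuous_on (closure S) f"
      using clS SU by (auto intro: continuous_on_subset[OF holomorphic_on_imp_continuous_on[OF hol]])
    show "bounded S" by (auto simp: S_def intro: bounded_Int)
    show "z \<in> S" using z R' by (auto simp: S_def)
    fix w assume w: "w \<in> frontier S"
    hence wS: "w \<in> S" using clS by (auto simp: frontier_def)
    have "Im w = 0 \<or> cmod w = R'"
    proof (rule ccontr)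
      assume "\<not> ?thesis"
      hence "w \<in> {w. Im w > 0} \<inter> ball 0 R'" using wS by (auto simp: S_def)
      moreover have "open ({w. Im w > 0} \<inter> ball 0 R')" by (intro open_Int open_halfspace_Im_gt) auto
      ultimately have "w \<in> interior S" by (rule_tac interiorI) (auto simp: S_def)
      thus False using w by (auto simp: frontier_def)
    qed
    thus "cmod (f w) \<le> K + e"
    proof
      assume "Im w = 0"
      hence "w = of_real (Re w)" by (simp add: complex_eq_iff)
      thus ?thesis using real[of "Re w"] \<open>e > 0\<close> by simp
    next
      assume w: "cmod w = R'"
      have "dist (f w) L < e / 2"
        by (rule R) (use w R'(1) in simp)
      \<comment> \<open>The real endpoint of the arc serves as comparison point: both values are
        close to \<open>L\<close>, and there the bound \<open>K\<close> is available.\<close>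
      moreover have "dist (f (of_real R')) L < e / 2"
        by (rule R) (use R'(1) R'0 in simp)
      ultimately have "dist (f w) (f (of_real R')) < e"
        by (rule dist_triangle_half_l)
      thus ?thesis using real[of R'] norm_triangle_sub[of "f w" "f (of_real R')"]
        by (simp add: dist_norm)
    qed
  qed
qed

lemma tendsto_inverse_shift_at_infinity: "((\<lambda>z. a / (z - b)) \<longlongrightarrow> 0) (at_infinity :: complex filter)"
proof -
  have "filterlim (\<lambda>z::complex. z + (- b)) at_infinity at_infinity"
    by (rule tendsto_add_filterlim_at_infinity'[OF filterlim_ident tendsto_const])
  hence "filterlim (\<lambda>z::complex. z - b) at_infinity at_infinity" by simp
  thus ?thesis by (intro tendsto_divide_0[OF tendsto_const])
qed

text \<open>Multiplying by the Blaschke product of the \<open>x k\<close> removes the poles in the upper half plane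
  without changing the modulus on the real axis.\<close>

lemma rational_bound_upper:
  fixes x \<alpha> \<beta> :: "'k \<Rightarrow> complex" and c :: complex and K :: "'k set"
  defines "h \<equiv> \<lambda>z. c + (\<Sum>k\<in>K. \<alpha> k / (z - x k) + \<beta> k / (z - cnj (x k)))"
  assumes fin: "finite K" and up: "\<And>k. k \<in> K \<Longrightarrow> Im (x k) > 0"
    and bnd: "\<And>y::real. cmod (h (of_real y)) \<le> A"
    and z: "Im z \<ge> 0" "\<And>k. k \<in> K \<Longrightarrow> z \<noteq> x k"
  shows "cmod (h z) \<le> A * (\<Prod>k\<in>K. cmod (z - cnj (x k)) / cmod (z - x k))"
proof -
  define B where "B L w = (\<Prod>k\<in>L. (w - x k) / (w - cnj (x k)))" for L w
  \<comment> \<open>The product of \<open>B K\<close> and \<open>h\<close> with the poles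
    \<open>x k\<close> cancelled by hand, so that holomorphy is visible also at these
    points.\<close>
  define f where "f w = B K w * (c + (\<Sum>k\<in>K. \<beta> k / (w - cnj (x k))))
     + (\<Sum>k\<in>K. \<alpha> k / (w - cnj (x k)) * B (K - {k}) w)" for w
  have ne: "w \<noteq> cnj (x k)" if "k \<in> K" "Im w \<ge> 0" for w k
    using up[OF that(1)] that(2) by (auto simp: complex_eq_iff)
  have fB: "f w = B K w * h w" if w: "\<And>k. k \<in> K \<Longrightarrow> w \<noteq> x k" for w
  proof -
    have "\<alpha> k / (w - cnj (x k)) * B (K - {k}) w = B K w * (\<alpha> k / (w - x k))" if "k \<in> K" for k
    proof -
      have "B K w = (w - x k) / (w - cnj (x k)) * B (K - {k}) w"
        unfolding B_def using fin that by (rule prod.remove)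
      thus ?thesis using w[OF that] by simp
    qed
    hence "(\<Sum>k\<in>K. \<alpha> k / (w - cnj (x k)) * B (K - {k}) w) = B K w * (\<Sum>k\<in>K. \<alpha> k / (w - x k))"
      unfolding sum_distrib_left by (intro sum.cong refl)
    thus ?thesis
      unfolding f_def h_def by (simp only: sum.distrib distrib_left add_ac)
  qed
  have B_real: "cmod (B K (of_real y)) = 1" for y
  proof -
    have "cmod ((of_real y - x k) / (of_real y - cnj (x k))) = 1" if "k \<in> K" for k
    proof -
      have "of_real y - cnj (x k) = cnj (of_real y - x k)" by simp
      hence "cmod (of_real y - cnj (x k)) = cmod (of_real y - x k)"
        by (simp only: complex_mod_cnj)
      moreover have "of_real y - x k \<noteq> 0" using up[OF that] by (auto simp: complex_eq_iff)
      ultimately show ?thesis by (simp add: norm_divide)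
    qed
    thus ?thesis by (simp add: B_def prod_norm[symmetric])
  qed
  define U where "U = UNIV - (\<lambda>k. cnj (x k)) ` K"
  have "cmod (f z) \<le> A"
  proof (rule half_plane_maximum_principle[where f = f and z = z and U = U and L = c])
    show "f holomorphic_on U"
      unfolding f_def B_def U_def by (auto intro!: holomorphic_intros)
    show "open U" unfolding U_def using fin by (intro open_Diff finite_imp_closed) auto
    show "{z. Im z \<ge> 0} \<subseteq> U" using ne by (auto simp: U_def)
    have "((\<lambda>w. (w - x k) / (w - cnj (x k))) \<longlongrightarrow> 1) at_infinity" for k
    proof -
      have "((\<lambda>w. 1 + (cnj (x k) - x k) / (w - cnj (x k))) \<longlongrightarrow> 1 + 0) at_infinity"
        by (intro tendsto_add tendsto_const tendsto_inverse_shift_at_infinity)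
      hence "((\<lambda>w. 1 + (cnj (x k) - x k) / (w - cnj (x k))) \<longlongrightarrow> 1) at_infinity" by simp
      moreover have "\<forall>\<^sub>F w in at_infinity. w \<noteq> cnj (x k)"
        unfolding eventually_at_infinity by (rule exI[of _ "cmod (x k) + 1"]) auto
      hence "\<forall>\<^sub>F w in at_infinity. 1 + (cnj (x k) - x k) / (w - cnj (x k)) = (w - x k) / (w - cnj (x k))"
        by eventually_elim (simp add: divide_simps)
      ultimately show ?thesis
        by (rule Lim_transform_eventually)
    qed
    \<comment> \<open>Each Blaschke factor tends to 1, so \<open>f\<close> has the same limit
      \<open>c\<close> at infinity as \<open>h\<close>.\<close>
    hence Blim: "(B L \<longlongrightarrow> 1) at_infinity" for L
      unfolding B_def using tendsto_prod[of L "\<lambda>k w. (w - x k) / (w - cnj (x k))" "\<lambda>_. 1"] by simp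
    have "(f \<longlongrightarrow> 1 * (c + (\<Sum>k\<in>K. 0)) + (\<Sum>k\<in>K. 0 * 1)) at_infinity"
      unfolding f_def by (intro tendsto_intros Blim tendsto_inverse_shift_at_infinity)
    thus "(f \<longlongrightarrow> c) at_infinity" by simp
    fix y :: real
    have "f (of_real y) = B K (of_real y) * h (of_real y)"
      by (rule fB) (auto simp: complex_eq_iff dest!: up)
    thus "cmod (f (of_real y)) \<le> A" using bnd[of y] by (simp add: norm_mult B_real)
  qed fact
  moreover have "cmod (h z) = cmod (f z) * (\<Prod>k\<in>K. cmod (z - cnj (x k)) / cmod (z - x k))"
  proof -
    have "B K z \<noteq> 0" using fin z ne[OF _ z(1)] by (auto simp: B_def)
    hence "h z = f z * (1 / B K z)" using fB[OF z(2)] by simp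
    also have "1 / B K z = (\<Prod>k\<in>K. (z - cnj (x k)) / (z - x k))"
      unfolding B_def prod_dividef by simp
    finally show ?thesis by (simp add: norm_mult prod_norm[symmetric] norm_divide)
  qed
  ultimately show ?thesis by (auto intro!: mult_right_mono prod_nonneg)
qed

text \<open>The constant does not depend on the height of \<open>x\<close>. With \<open>d\<close>,
  \<open>h\<close>, \<open>y\<close> as in the proof: if \<open>y \<ge> 2 * h\<close>, then
  \<open>h + y\<close> is at most \<open>3 * (y - h)\<close>; otherwise it is at most
  \<open>3 * h\<close>, hence at most three times the horizontal distance.\<close>

lemma blaschke_factor_bound:
  assumes "Im x > 0" "0 \<le> Im z" "Im z \<le> \<bar>Re x - Re z\<bar>"
  shows "cmod (z - cnj x) \<le> 4 * cmod (z - x)"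
proof -
  define d h y where "d = Re z - Re x" and "h = Im z" and "y = Im x"
  have h: "0 \<le> h" "h \<le> \<bar>d\<bar>" "0 < y" using assms by (auto simp: d_def h_def y_def)
  have hd: "h\<^sup>2 \<le> d\<^sup>2" using h by (simp add: abs_le_square_iff[symmetric])
  have "(h + y)\<^sup>2 \<le> 9 * d\<^sup>2 + 9 * (h - y)\<^sup>2"
  proof (cases "y \<ge> 2 * h")
    case True
    hence "(h + y)\<^sup>2 \<le> (3 * (y - h))\<^sup>2" using h by (intro power_mono) auto
    also have "\<dots> = 9 * (h - y)\<^sup>2" by (simp add: power2_eq_square algebra_simps)
    finally show ?thesis using zero_le_power2[of d] by linarith
  next
    case False
    hence "(h + y)\<^sup>2 \<le> (3 * h)\<^sup>2" using h by (intro power_mono) auto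
    also have "\<dots> \<le> 9 * d\<^sup>2" using hd by (simp add: power_mult_distrib)
    finally show ?thesis using zero_le_power2[of "h - y"] by linarith
  qed
  moreover have "0 \<le> 6 * d\<^sup>2 + 7 * (h - y)\<^sup>2" by simp
  ultimately have "d\<^sup>2 + (h + y)\<^sup>2 \<le> 16 * (d\<^sup>2 + (h - y)\<^sup>2)"
    unfolding distrib_left by linarith
  hence "(cmod (z - cnj x))\<^sup>2 \<le> (4 * cmod (z - x))\<^sup>2"
    by (simp add: cmod_power2 power_mult_distrib d_def h_def y_def)
  thus ?thesis by (rule power2_le_imp_le) simp
qed

text \<open>The coefficients are paired by conjugation, so \<open>h\<close> is real on the axis, and
  its imaginary part at height \<open>y\<close> is at most a derivative bound times
  \<open>y\<close>.\<close>

lemma Im_bound_near_real_axis: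
  fixes x \<alpha> :: "'k \<Rightarrow> complex" and c a \<eta> :: real and K :: "'k set"
  defines "h \<equiv> \<lambda>z. of_real c + (\<Sum>k\<in>K. \<alpha> k / (z - x k) + cnj (\<alpha> k) / (z - cnj (x k)))"
  assumes fin: "finite K" and up: "\<And>k. k \<in> K \<Longrightarrow> Im (x k) > 0"
    and sep: "\<And>k. k \<in> K \<Longrightarrow> \<bar>Re (x k) - a\<bar> \<ge> \<eta>" and \<eta>: "\<eta> > 0"
    and bnd: "\<And>y::real. cmod (h (of_real y)) \<le> A"
    and y: "0 \<le> y" "y \<le> \<eta> / 4"
  shows "\<bar>Im (h (Complex a y))\<bar> \<le> 4 * 4 ^ card K * A / \<eta> * y"
proof -
  have A: "A \<ge> 0" using bnd[of 0] norm_ge_zero order_trans by blast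
  have hcnj: "h (cnj z) = cnj (h z)" for z
    by (simp add: h_def add.commute)
  define U where "U = (ball (of_real a) \<eta> :: complex set)"
  have ReU: "\<bar>Re z - a\<bar> < \<eta>" if "z \<in> U" for z
    using that abs_Re_le_cmod[of "z - of_real a"] by (simp add: U_def dist_norm norm_minus_commute)
  have neU: "z \<noteq> x k" "z \<noteq> cnj (x k)" if "z \<in> U" "k \<in> K" for z k
    using ReU[OF that(1)] sep[OF that(2)] by auto
  have holU: "h holomorphic_on U"
    unfolding h_def using neU by (auto intro!: holomorphic_intros)
  \<comment> \<open>In this half disc every pole has horizontal distance at least
    \<open>\<eta> / 2\<close> from \<open>z\<close>, which is no less than \<open>Im z\<close>; so
    each Blaschke factor costs at most 4.\<close>
  have upper: "cmod (h z) \<le> A * 4 ^ card K" if z: "z \<in> cball (of_real a) (\<eta> / 2)" "Im z \<ge> 0" for z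
  proof -
    have zU: "z \<in> U" using z \<eta> by (auto simp: U_def)
    have z2: "\<bar>Re z - a\<bar> \<le> \<eta> / 2" "Im z \<le> \<eta> / 2"
      using z abs_Re_le_cmod[of "z - of_real a"] abs_Im_le_cmod[of "z - of_real a"]
      by (simp_all add: dist_norm norm_minus_commute)
    have "cmod (h z) \<le> A * (\<Prod>k\<in>K. cmod (z - cnj (x k)) / cmod (z - x k))"
      unfolding h_def by (rule rational_bound_upper[OF fin up bnd[unfolded h_def] z(2)]) (use neU zU in auto)
    also have "\<dots> \<le> A * (\<Prod>k\<in>K. 4)"
    proof (intro mult_left_mono prod_mono conjI A)
      fix k assume k: "k \<in> K"
      have "cmod (z - cnj (x k)) \<le> 4 * cmod (z - x k)"
        using z2 sep[OF k] z(2) by (intro blaschke_factor_bound up k) linarith+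
      thus "cmod (z - cnj (x k)) / cmod (z - x k) \<le> 4"
        using neU(1)[OF zU k] by (simp add: divide_le_eq)
    qed auto
    finally show ?thesis by simp
  qed
  \<comment> \<open>The lower half disc follows by reflection.\<close>
  have disc: "cmod (h z) \<le> A * 4 ^ card K" if z: "z \<in> cball (of_real a) (\<eta> / 2)" for z
  proof (cases "Im z \<ge> 0")
    case False
    have "dist (of_real a) (cnj z) = dist (of_real a) z"
      unfolding dist_norm by (metis complex_cnj_complex_of_real complex_cnj_diff complex_mod_cnj)
    hence "cmod (h (cnj z)) \<le> A * 4 ^ card K"
      using z False by (intro upper) auto
    thus ?thesis by (simp add: hcnj)
  qed (use upper z in auto)
  \<comment> \<open>Discs of radius \<open>\<eta> / 4\<close> about points of the quarter disc stay
    where \<open>h\<close> is bounded; this radius enters Cauchy's estimate.\<close>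
  have dist4: "cball w (\<eta> / 4) \<subseteq> cball (of_real a) (\<eta> / 2)"
      if "w \<in> cball (of_real a) (\<eta> / 4)" for w :: complex
  proof
    fix v assume "v \<in> cball w (\<eta> / 4)"
    thus "v \<in> cball (of_real a) (\<eta> / 2)"
      using that dist_triangle[of "of_real a" v w] by simp
  qed
  have "cmod (h (Complex a y) - h (of_real a)) \<le> 4 * 4 ^ card K * A / \<eta> * cmod (Complex a y - of_real a)"
  proof (rule field_differentiable_bound[of "cball (of_real a) (\<eta> / 4)" h "deriv h"])
    fix w :: complex assume w: "w \<in> cball (of_real a) (\<eta> / 4)"
    hence wU: "w \<in> U" using \<eta> by (auto simp: U_def)
    show "(h has_field_derivative deriv h w) (at w within cball (of_real a) (\<eta> / 4))"
      using holU wU by (intro DERIV_subset[OF holomorphic_derivI[of h U]]) (auto simp: U_def)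
    have sub: "cball w (\<eta> / 4) \<subseteq> U"
      using dist4[OF w] \<eta> by (auto simp: U_def)
    have "norm ((deriv ^^ 1) h w) \<le> fact 1 * (A * 4 ^ card K) / (\<eta> / 4) ^ 1"
    proof (rule Cauchy_inequality)
      show "h holomorphic_on ball w (\<eta> / 4)"
        by (rule holomorphic_on_subset[OF holU]) (use sub ball_subset_cball in blast)
      show "continuous_on (cball w (\<eta> / 4)) h"
        by (rule continuous_on_subset[OF holomorphic_on_imp_continuous_on[OF holU] sub])
      show "cmod (h v) \<le> A * 4 ^ card K" if "cmod (w - v) = \<eta> / 4" for v
        by (rule disc) (use that dist4[OF w] in \<open>auto simp: dist_norm\<close>)
    qed (use \<eta> in auto)
    thus "cmod (deriv h w) \<le> 4 * 4 ^ card K * A / \<eta>" by (simp add: mult_ac)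
  next
    show "Complex a y \<in> cball (of_real a) (\<eta> / 4)"
      using y by (simp add: dist_norm complex_diff cmod_def complex_of_real_def)
  qed (use \<eta> in auto)
  moreover have "cmod (Complex a y - of_real a) = y"
    using y by (simp add: complex_of_real_def cmod_def)
  moreover have "Im (h (of_real a)) = 0"
    using arg_cong[OF hcnj[of "of_real a"], of Im] by simp
  ultimately show ?thesis
    using abs_Im_le_cmod[of "h (Complex a y) - h (of_real a)"] by simp
qed

subsection \<open>Exponential lower bounds\<close>

text \<open>After the last time \<open>r\<close> up to \<open>t\<close> at which \<open>y\<close> is
  at least \<delta> (or after 0 if there is none), the differential inequality holds throughout, so
  \<open>y s * exp (D * s)\<close> is nondecreasing from \<open>r\<close> to
  \<open>t\<close>.\<close>

lemma exp_lower_bound: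
  fixes y y' :: "real \<Rightarrow> real"
  assumes cont: "continuous_on {0..} y" and pos: "\<And>t. t \<ge> 0 \<Longrightarrow> y t > 0"
    and der: "\<And>t. t > 0 \<Longrightarrow> (y has_real_derivative y' t) (at t)"
    and low: "\<And>t. t > 0 \<Longrightarrow> y t \<le> \<delta> \<Longrightarrow> y' t \<ge> - D * y t"
    and \<delta>: "\<delta> > 0" and D: "D \<ge> 0" and t: "t \<ge> 0"
  shows "y t \<ge> min (y 0) \<delta> * exp (- D * t)"
proof -
  \<comment> \<open>Adding 0 makes the set nonempty; it is compact, so \<open>r\<close> is
    attained.\<close>
  define A where "A = {0} \<union> {s \<in> {0..t}. \<delta> \<le> y s}"
  have "closed ({0..t} \<inter> y -` {\<delta>..})"
    by (intro continuous_closed_preimage continuous_on_subset[OF cont]) auto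
  moreover have "{0..t} \<inter> y -` {\<delta>..} = {s \<in> {0..t}. \<delta> \<le> y s}" by auto
  ultimately have "closed {s \<in> {0..t}. \<delta> \<le> y s}" by simp
  hence "compact A"
    unfolding A_def by (intro compact_Un) (auto simp: compact_eq_bounded_closed intro: bounded_subset[of "{0..t}"])
  then obtain r where r: "r \<in> A" "\<And>s. s \<in> A \<Longrightarrow> s \<le> r"
    using compact_attains_sup[of A] by (auto simp: A_def)
  have r0: "0 \<le> r" "r \<le> t" using r(1) t by (auto simp: A_def)
  have yr: "y r \<ge> min (y 0) \<delta>" using r(1) by (auto simp: A_def)
  define u where "u s = y s * exp (D * s)" for s
  have "u r \<le> u t"
  proof (rule DERIV_nonneg_imp_increasing_open[OF r0(2)])
    fix s assume s: "r < s" "s < t"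
    have "y s < \<delta>" using r(2)[of s] s r0 by (force simp: A_def)
    hence "y' s + D * y s \<ge> 0" using low[of s] s r0 by simp
    moreover have "(u has_real_derivative (y' s + D * y s) * exp (D * s)) (at s)"
      unfolding u_def using s r0 by (auto intro!: derivative_eq_intros der simp: algebra_simps)
    ultimately show "\<exists>v. (u has_real_derivative v) (at s) \<and> 0 \<le> v"
      by (intro exI[of _ "(y' s + D * y s) * exp (D * s)"]) auto
  next
    show "continuous_on {r..t} u"
      unfolding u_def by (intro continuous_intros continuous_on_subset[OF cont]) (use r0 in auto)
  qed
  moreover have "min (y 0) \<delta> \<le> u r"
  proof -
    have "min (y 0) \<delta> * 1 \<le> y r * exp (D * r)"
      using yr pos[OF r0(1)] D r0 by (intro mult_mono) auto
    thus ?thesis by (simp add: u_def)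
  qed
  ultimately have "min (y 0) \<delta> * exp (- D * t) \<le> u t * exp (- D * t)"
    by (intro mult_right_mono) auto
  also have "\<dots> = y t" by (simp add: u_def mult.assoc exp_add[symmetric])
  finally show ?thesis .
qed

section \<open>Spin axis and poles doubled by conjugation\<close>

lemma sum_doubled:
  fixes f :: "'k \<times> bool \<Rightarrow> 'a::ab_group_add"
  assumes "finite K"
  shows "(\<Sum>q\<in>K \<times> UNIV. f q) = (\<Sum>k\<in>K. f (k, True)) + (\<Sum>k\<in>K. f (k, False))"
    and "j \<in> K \<Longrightarrow> (\<Sum>q\<in>K \<times> UNIV - {(j, b)}. f q)
      = (\<Sum>k\<in>K - {j}. f (k, b)) + (\<Sum>k\<in>K. f (k, \<not> b))"
proof -
  have "(\<Sum>q\<in>K \<times> UNIV. f q) = (\<Sum>k\<in>K. \<Sum>b\<in>UNIV. f (k, b))"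
    by (simp add: sum.cartesian_product)
  thus 1: "(\<Sum>q\<in>K \<times> UNIV. f q) = (\<Sum>k\<in>K. f (k, True)) + (\<Sum>k\<in>K. f (k, False))"
    by (simp add: UNIV_bool sum.distrib add.commute)
  assume j: "j \<in> K"
  have "(\<Sum>q\<in>K \<times> UNIV. f q) = f (j, b) + (\<Sum>q\<in>K \<times> UNIV - {(j, b)}. f q)"
    using assms j by (intro sum.remove) auto
  moreover have "(\<Sum>k\<in>K. f (k, b)) = f (j, b) + (\<Sum>k\<in>K - {j}. f (k, b))"
    using assms j by (intro sum.remove) auto
  ultimately show "(\<Sum>q\<in>K \<times> UNIV - {(j, b)}. f q)
      = (\<Sum>k\<in>K - {j}. f (k, b)) + (\<Sum>k\<in>K. f (k, \<not> b))"
    using 1 by (cases b) (auto simp: algebra_simps)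
qed

text \<open>The vector whose product with the field is the prescribed velocity. The normalisation
  keeps its norm bounded whatever the size of \<open>s\<close>.\<close>

definition spin_axis :: "complex ^ 3 \<Rightarrow> complex ^ 3" where
  "spin_axis s = (1 / cdot s (cnjv s)) *s ccross s (cnjv s)"

lemma cdot_cnjv_self_nonzero: "s \<noteq> 0 \<Longrightarrow> cdot s (cnjv s) \<noteq> 0"
  by (simp add: cdot_cnjv_self)

lemma cnjv_cnjv [simp]: "cnjv (cnjv v) = v"
  by (simp add: cnjv_def vec_eq_iff)

lemma cnjv_smult: "cnjv (c *s v) = cnj c *s cnjv v"
  by (simp add: cnjv_def vec_eq_iff)

lemma cnjv_cvec [simp]: "cnjv (cvec v) = cvec v"
  by (simp add: cnjv_def cvec_def vec_eq_iff)

lemma norm_cnjv [simp]: "norm (cnjv v) = norm v"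
  by (simp add: cnjv_def norm_vec_def)

lemma norm_cvec [simp]: "norm (cvec v) = norm v"
  by (simp add: cvec_def norm_vec_def)

text \<open>The axis of \<open>s = u + i v\<close> is \<open>- 2 i u \<times> v / \<bar>s\<bar>\<^sup>2\<close>, so it is purely imaginary.\<close>

lemma cnjv_spin_axis: "cnjv (spin_axis s) = - spin_axis s"
proof -
  have "ccross (cnjv s) s = - ccross s (cnjv s)"
    by (simp add: vec_eq_iff forall_3 ccross_nth)
  thus ?thesis
    by (simp add: spin_axis_def cnjv_smult cnjv_ccross cnjv_cdot cdot_commute[of "cnjv s" s] csmult.minus_right)
qed

lemma cdot_spin_axis [simp]: "cdot (spin_axis s) s = 0" "cdot (spin_axis s) (cnjv s) = 0"
  by (simp_all add: spin_axis_def) (simp_all add: cdot_3 ccross_nth algebra_simps)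

text \<open>By \<open>isotropic_ccross\<close> with \<open>v = cnjv s\<close>, the vector
  \<open>ccross s b\<close> is minus \<open>cdot (spin_axis s) b\<close> times \<open>s\<close>.
  This passes between the velocity formula and the vector equation that propagates in time.\<close>

lemma first_order_iff_spin_axis:
  assumes "s \<noteq> 0" "cdot s s = 0" "cdot s b = 0"
  shows "v *s s + ccross s b = 0 \<longleftrightarrow> v = cdot (spin_axis s) b"
proof -
  define d where "d = cdot s (cnjv s)"
  have d: "d \<noteq> 0" using cdot_cnjv_self_nonzero[OF assms(1)] by (simp add: d_def)
  have "d *s ccross s b = - (d * cdot (spin_axis s) b) *s s"
    using isotropic_ccross[OF assms(2,3), of "cnjv s"] d by (simp add: spin_axis_def d_def)
  hence "ccross s b = - cdot (spin_axis s) b *s s"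
    using d by (simp add: vec_eq_iff) (metis (no_types, lifting) mult.assoc mult_cancel_left mult_minus_right)
  hence "v *s s + ccross s b = (v - cdot (spin_axis s) b) *s s"
    by (simp add: vec_eq_iff algebra_simps)
  thus ?thesis using assms(1) by simp
qed

text \<open>Pole \<open>(k, True)\<close> is \<open>x k\<close> with spin \<open>s k\<close>, pole \<open>(k, False)\<close> is its complex conjugate with spin
  \<open>- cnjv (s k)\<close>; this turns \<open>m\<close> into \<open>m0 + i \<Sum>q S q / (y - z q)\<close>.\<close>

definition dbl :: "('k \<Rightarrow> complex) \<Rightarrow> 'k \<times> bool \<Rightarrow> complex" where
  "dbl x q = (if snd q then x (fst q) else cnj (x (fst q)))"

definition dbl_spin :: "('k \<Rightarrow> complex ^ 3) \<Rightarrow> 'k \<times> bool \<Rightarrow> complex ^ 3" where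
  "dbl_spin s q = (if snd q then s (fst q) else - cnjv (s (fst q)))"

lemma dbl_simps [simp]:
  "dbl x (k, True) = x k" "dbl x (k, False) = cnj (x k)"
  "dbl_spin s (k, True) = s k" "dbl_spin s (k, False) = - cnjv (s k)"
  by (simp_all add: dbl_def dbl_spin_def)

lemma cnjv_diff: "cnjv (u - v) = cnjv u - cnjv v"
  and cnjv_add: "cnjv (u + v) = cnjv u + cnjv v"
  and cnjv_minus: "cnjv (- u) = - cnjv u"
  and cnjv_zero: "cnjv 0 = 0"
  and cnjv_sum: "cnjv (sum f A) = (\<Sum>k\<in>A. cnjv (f k))"
  by (simp_all add: cnjv_def vec_eq_iff)

text \<open>The summand of \<open>cnj (x j t)\<close> belongs to the field at \<open>x j t\<close>,
  since only the pole itself is left out. The minus sign for the conjugate pole arises because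
  \<open>\<i> *s cvec m0\<close> is purely imaginary.\<close>

lemma pole_field_eq_bfield:
  assumes "j \<in> {1..N}"
  shows "pole_field N m0 s x j t
    = bfield ({1..N} \<times> UNIV) (\<i> *s cvec m0) (dbl (\<lambda>k. x k t)) (dbl_spin (\<lambda>k. s k t)) (j, True)"
    and "- cnjv (pole_field N m0 s x j t)
    = bfield ({1..N} \<times> UNIV) (\<i> *s cvec m0) (dbl (\<lambda>k. x k t)) (dbl_spin (\<lambda>k. s k t)) (j, False)"
  unfolding pole_field_def bfield_def sum_doubled(2)[OF finite_atLeastAtMost assms]
  by (simp_all add: csmult.minus_right sum_negf cnjv_diff cnjv_add cnjv_minus cnjv_smult cnjv_sum)

lemma inj_on_dbl:
  assumes "\<And>k. k \<in> K \<Longrightarrow> Im (x k) > 0" "inj_on x K"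
  shows "inj_on (dbl x) (K \<times> UNIV)"
proof (rule inj_onI)
  fix p q assume "p \<in> K \<times> (UNIV :: bool set)" "q \<in> K \<times> (UNIV :: bool set)" and eq: "dbl x p = dbl x q"
  then obtain j b k c where [simp]: "p = (j, b)" "q = (k, c)" and jk: "j \<in> K" "k \<in> K" by auto
  have "Im (dbl x (j, b)) = Im (dbl x (k, c))" using eq by simp
  hence "b = c" using assms(1)[OF jk(1)] assms(1)[OF jk(2)] by (cases b; cases c) auto
  moreover from this have "x j = x k" using eq by (cases b) auto
  ultimately show "p = q" using inj_onD[OF assms(2)] jk by auto
qed

lemma sphere_valued_constraints:
  fixes N :: nat and x :: "nat \<Rightarrow> complex" and s :: "nat \<Rightarrow> complex ^ 3"
  assumes up: "\<And>k. k \<in> {1..N} \<Longrightarrow> Im (x k) > 0"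
    and inj: "inj_on x {1..N}"
    and m: "\<And>y. cvec (m y) = cvec m0
        + \<i> *s (\<Sum>j\<in>{1..N}. (1 / (complex_of_real y - x j)) *s s j)
        - \<i> *s (\<Sum>j\<in>{1..N}. (1 / (complex_of_real y - cnj (x j))) *s cnjv (s j))"
    and sphere: "\<And>y. m y \<in> sphere 0 1"
    and q: "q \<in> {1..N} \<times> UNIV"
  defines "Z \<equiv> dbl x" and "S \<equiv> dbl_spin s"
  shows "cdot (S q) (S q) = 0" "cdot (S q) (bfield ({1..N} \<times> UNIV) (\<i> *s cvec m0) Z S q) = 0"
proof -
  let ?P = "{1..N} \<times> (UNIV :: bool set)"
  have fin: "finite ?P" by simp
  have inj': "inj_on Z ?P" unfolding Z_def by (rule inj_on_dbl[OF up inj])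
  have nonreal: "Im (Z p) \<noteq> 0" if "p \<in> ?P" for p
    using that up by (cases p; cases "snd p") (force simp: Z_def)+
  have "cvec m0 + \<i> *s (\<Sum>q\<in>?P. (1 / (of_real y - Z q)) *s S q) = cvec (m y)" for y
    unfolding m sum_doubled(1)[OF finite_atLeastAtMost]
    by (simp add: Z_def S_def csmult.minus_right sum_negf csmult.add_right)
  hence unit: "cdot (cvec m0 + \<i> *s (\<Sum>q\<in>?P. (1 / (of_real y - Z q)) *s S q))
      (cvec m0 + \<i> *s (\<Sum>q\<in>?P. (1 / (of_real y - Z q)) *s S q)) = 1" for y :: real
    using cvec_unit_sphere[OF sphere] by simp
  show "cdot (S q) (S q) = 0" "cdot (S q) (bfield ?P (\<i> *s cvec m0) Z S q) = 0"
    by (rule unit_sphere_constraints[OF fin q inj' nonreal unit]; assumption)+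
qed

text \<open>At time 0 the velocity law is rewritten as the vector equation for the doubled system,
  propagated, and converted back at time \<open>t\<close>.\<close>

lemma rational_solution_velocity:
  assumes sol: "rational_solution \<sigma> N {0..} m0 s x m" and j: "j \<in> {1..N}" and t: "t \<ge> 0"
  shows "(x j has_vector_derivative cdot (spin_axis (s j t)) (pole_field N m0 s x j t)) (at t within {0..})"
proof -
  let ?K = "{1..N}"
  define P where "P = ?K \<times> (UNIV :: bool set)"
  define xd where "xd k \<tau> = vector_derivative (x k) (at \<tau> within {0..})" for k \<tau>
  define r :: "nat \<times> bool \<Rightarrow> complex" where "r q = (if snd q then 1 else -1)" for q
  define z where "z q \<tau> = dbl (\<lambda>k. x k \<tau>) q" for q \<tau>
  define zd where "zd q \<tau> = dbl (\<lambda>k. xd k \<tau>) q" for q \<tau>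
  define S where "S q \<tau> = dbl_spin (\<lambda>k. s k \<tau>) q" for q \<tau>
  define M where "M = \<i> *s cvec m0"
  define b where "b p \<tau> = bfield P M (\<lambda>q. z q \<tau>) (\<lambda>q. S q \<tau>) p" for p \<tau>
  note sol' = sol[unfolded rational_solution_def]
  have s0: "s k \<tau> \<noteq> 0" and up: "Im (x k \<tau>) > 0" if "k \<in> ?K" "\<tau> \<ge> 0" for k \<tau>
    using sol' that by auto
  have inj: "inj_on (\<lambda>k. x k \<tau>) ?K" if "\<tau> \<ge> 0" for \<tau>
    using sol' that by (intro inj_onI) (metis atLeast_iff)
  have m: "cvec (m y \<tau>) = cvec m0
        + \<i> *s (\<Sum>j\<in>{1..N}. (1 / (complex_of_real y - x j \<tau>)) *s s j \<tau>)
        - \<i> *s (\<Sum>j\<in>{1..N}. (1 / (complex_of_real y - cnj (x j \<tau>))) *s cnjv (s j \<tau>))"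
    if "\<tau> \<ge> 0" for y \<tau> using sol' that by auto
  have sphere: "m y \<tau> \<in> sphere 0 1" if "\<tau> \<ge> 0" for y \<tau>
    using sol' that unfolding half_wave_maps_def by auto
  \<comment> \<open>Smoothness ensures that \<open>vector_derivative\<close>, chosen by description,
    really is the derivative.\<close>
  have dx: "(x k has_vector_derivative xd k \<tau>) (at \<tau> within {0..})" if "k \<in> ?K" "\<tau> \<ge> 0" for k \<tau>
  proof -
    have "smooth_on_interval {0..} (x k)" using sol' that by auto
    then obtain D where D: "\<forall>t\<in>{0..}. D 0 t = x k t"
      "\<forall>n. \<forall>t\<in>{0..}. (D n has_vector_derivative D (Suc n) t) (at t within {0..})"
      unfolding smooth_on_interval_def by blast
    have "(x k has_vector_derivative D 1 \<tau>) (at \<tau> within {0..})"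
      by (rule has_vector_derivative_transform[of \<tau> "{0..}" "x k" "D 0"]) (use D that in auto)
    thus ?thesis unfolding xd_def
      by (metis has_vector_derivative_def differentiable_def differentiableI_vector vector_derivative_works)
  qed
  have ds: "(s k has_vector_derivative
           (- 2) *s (\<Sum>l\<in>?K - {k}. (1 / (x k \<tau> - x l \<tau>)\<^sup>2) *s ccross (s k \<tau>) (s l \<tau>)))
        (at \<tau> within {0..})" if "k \<in> ?K" "\<tau> \<ge> 0" for k \<tau>
    using sol' that by auto
  have dxd: "(xd k has_vector_derivative
           4 * (\<Sum>l\<in>?K - {k}. cdot (s k \<tau>) (s l \<tau>) / (x k \<tau> - x l \<tau>) ^ 3))
        (at \<tau> within {0..})" if "k \<in> ?K" "\<tau> \<ge> 0" for k \<tau>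
    using sol' that unfolding xd_def[abs_def] by auto
  have z_eq: "z (k, True) = x k" "z (k, False) = (\<lambda>\<tau>. cnj (x k \<tau>))"
    and zd_eq: "zd (k, True) = xd k" "zd (k, False) = (\<lambda>\<tau>. cnj (xd k \<tau>))"
    and S_eq: "S (k, True) = s k" "S (k, False) = (\<lambda>\<tau>. - cnjv (s k \<tau>))"
    and r_eq: "r (k, True) = 1" "r (k, False) = -1" for k
    by (auto simp: z_def zd_def S_def r_def)
  have b_eq: "b (k, True) \<tau> = pole_field N m0 s x k \<tau>" "b (k, False) \<tau> = - cnjv (pole_field N m0 s x k \<tau>)"
    if "k \<in> ?K" for k \<tau>
    unfolding b_def P_def M_def z_def S_def using pole_field_eq_bfield[OF that] by simp_all
  have split: "(\<exists>k\<in>?K. p = (k, True)) \<or> (\<exists>k\<in>?K. p = (k, False))" if "p \<in> P" for p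
    using that by (cases p; cases "snd p") (auto simp: P_def)
  have iso: "cdot (S p \<tau>) (S p \<tau>) = 0" and con: "cdot (S p \<tau>) (b p \<tau>) = 0"
      if "p \<in> P" "\<tau> \<ge> 0" for p \<tau>
    unfolding b_def S_def z_def P_def M_def
    by (rule sphere_valued_constraints[where m = "\<lambda>y. m y \<tau>" and x
        = "\<lambda>k. x k \<tau>" and s = "\<lambda>k. s k \<tau>" and N = N,
          OF up inj m sphere]; use that in \<open>simp add: P_def\<close>)+
  have fo: "zd p t *s S p t + r p *s ccross (S p t) (b p t) = 0" if p: "p \<in> P" for p
    unfolding b_def
  proof (rule first_order_propagates[where r = r])
    show "finite P" by (simp add: P_def)
    show "r p * r p = 1" for p by (simp add: r_def)
    show "inj_on (\<lambda>q. z q \<tau>) P" if "\<tau> \<ge> 0" for \<tau>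
      using inj_on_dbl[OF up inj] that by (simp add: z_def P_def)
    show "cdot (S p \<tau>) (S p \<tau>) = 0" if "p \<in> P" "\<tau> \<ge> 0" for p \<tau> using iso that .
    show "cdot (S p \<tau>) (bfield P M (\<lambda>q. z q \<tau>) (\<lambda>q. S q \<tau>) p) = 0"
        if "p \<in> P" "\<tau> \<ge> 0" for p \<tau>
      using con that by (simp add: b_def)
    show "p \<in> P" "t \<ge> 0" by fact+
  next
    fix p \<tau> assume p: "p \<in> P" and \<tau>: "(\<tau>::real) \<ge> 0"
    consider k where "k \<in> ?K" "p = (k, True)" | k where "k \<in> ?K" "p = (k, False)"
      using split[OF p] by blast
    note cases = this
    show "(z p has_vector_derivative zd p \<tau>) (at \<tau> within {0..})"
    proof (cases rule: cases)
      case 1 thus ?thesis using dx \<tau> by (simp add: z_eq zd_eq)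
    next
      case 2 thus ?thesis using dx[of _ \<tau>] \<tau>
        by (simp add: z_eq zd_eq bounded_linear.has_vector_derivative[OF bounded_linear_cnj])
    qed
    show "(zd p has_vector_derivative
        2 * (\<Sum>q\<in>P - {p}. (1 + r p * r q) * cdot (S p \<tau>) (S q \<tau>) / (z p \<tau> - z q \<tau>) ^ 3))
        (at \<tau> within {0..})"
    proof (cases rule: cases)
      case (1 k)
      thus ?thesis using dxd[of k \<tau>] \<tau> unfolding P_def 1(2) sum_doubled(2)[OF finite_atLeastAtMost 1(1)]
        by (simp add: z_eq zd_eq S_eq r_eq sum_distrib_left)
    next
      case (2 k)
      \<comment> \<open>The equations for conjugate poles are the conjugates of those for
        \<open>x k\<close>; the two minus signs of the spins cancel in the dot product.\<close>
      have "((\<lambda>\<tau>. cnj (xd k \<tau>)) has_vector_derivative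
          cnj (4 * (\<Sum>l\<in>?K - {k}. cdot (s k \<tau>) (s l \<tau>) / (x k \<tau>
              - x l \<tau>) ^ 3))) (at \<tau> within {0..})"
        by (intro bounded_linear.has_vector_derivative[OF bounded_linear_cnj] dxd 2 \<tau>)
      thus ?thesis unfolding P_def 2(2) sum_doubled(2)[OF finite_atLeastAtMost 2(1)]
        by (simp add: z_eq zd_eq S_eq r_eq sum_distrib_left cnjv_cdot cdot.minus_left cdot.minus_right)
    qed
    show "(S p has_vector_derivative
        - (\<Sum>q\<in>P - {p}. ((r p + r q) / (z p \<tau> - z q \<tau>)\<^sup>2) *s ccross (S p \<tau>) (S q \<tau>)))
        (at \<tau> within {0..})"
    proof (cases rule: cases)
      case (1 k)
      have "(-2) *s (\<Sum>l\<in>?K - {k}. (1 / (x k \<tau> - x l \<tau>)\<^sup>2) *s ccross (s k \<tau>) (s l \<tau>))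
          = - (\<Sum>l\<in>?K - {k}. (2 / (x k \<tau> - x l \<tau>)\<^sup>2) *s ccross (s k \<tau>) (s l \<tau>))"
        by (simp add: csmult.sum_right csmult.minus_left sum_negf)
      thus ?thesis using ds[OF 1(1) \<tau>] unfolding P_def 1(2) sum_doubled(2)[OF finite_atLeastAtMost 1(1)]
        by (simp add: z_eq S_eq r_eq)
    next
      case (2 k)
      have "((\<lambda>\<tau>. - cnjv (s k \<tau>)) has_vector_derivative
          - cnjv ((- 2) *s (\<Sum>l\<in>?K - {k}. (1 / (x k \<tau> - x l \<tau>)\<^sup>2) *s ccross (s k \<tau>) (s l \<tau>))))
          (at \<tau> within {0..})"
        by (intro has_vector_derivative_minus bounded_linear.has_vector_derivative[OF bounded_linear_cnjv] ds 2 \<tau>)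
      moreover have "- cnjv ((- 2) *s (\<Sum>l\<in>?K - {k}. (1 / (x k \<tau>
          - x l \<tau>)\<^sup>2) *s ccross (s k \<tau>) (s l \<tau>)))
          = - (\<Sum>l\<in>?K - {k}. (-2 / (cnj (x k \<tau>)
              - cnj (x l \<tau>))\<^sup>2) *s ccross (cnjv (s k \<tau>)) (cnjv (s l \<tau>)))"
        by (simp add: cnjv_smult cnjv_sum cnjv_ccross cnjv_minus csmult.sum_right csmult.minus_left sum_negf)
      ultimately show ?thesis unfolding P_def 2(2) sum_doubled(2)[OF finite_atLeastAtMost 2(1)]
        by (simp add: z_eq S_eq r_eq ccross.minus_left ccross.minus_right)
    qed
  next
    fix p assume p: "p \<in> P"
    have *: "xd k 0 *s s k 0 + ccross (s k 0) (pole_field N m0 s x k 0) = 0" if k: "k \<in> ?K" for k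
    proof -
      have "(x k has_vector_derivative cdot (spin_axis (s k 0)) (pole_field N m0 s x k 0)) (at 0 within {0..})"
        using sol' k unfolding spin_axis_def by auto
      hence "xd k 0 = cdot (spin_axis (s k 0)) (pole_field N m0 s x k 0)"
        \<comment> \<open>Derivatives within \<open>{0..}\<close> are unique also at the endpoint 0,
          so the prescribed initial velocity equals \<open>xd k 0\<close>.\<close>
        unfolding xd_def by (rule vector_derivative_within[rotated]) (simp add: at_within_Ici_at_right)
      thus ?thesis
        using first_order_iff_spin_axis[OF s0[OF k], of 0 "pole_field N m0 s x k 0"]
          iso[of "(k, True)" 0] con[of "(k, True)" 0] k by (simp add: P_def S_eq b_eq)
    qed
    show "zd p 0 *s S p 0 + r p *s ccross (S p 0) (bfield P M (\<lambda>q. z q 0) (\<lambda>q. S q 0) p) = 0"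
      unfolding b_def[symmetric]
    proof -
      from split[OF p] show "zd p 0 *s S p 0 + r p *s ccross (S p 0) (b p 0) = 0"
      proof (elim disjE bexE)
        fix k assume "k \<in> ?K" "p = (k, True)"
        thus ?thesis using *[of k] by (simp add: zd_eq S_eq r_eq b_eq)
      next
        fix k assume k: "k \<in> ?K" "p = (k, False)"
        have "cnjv (xd k 0 *s s k 0 + ccross (s k 0) (pole_field N m0 s x k 0)) = 0"
          using *[OF k(1)] by (simp only: cnjv_zero)
        thus ?thesis using k
          by (simp add: zd_eq S_eq r_eq b_eq cnjv_add cnjv_smult cnjv_ccross csmult.minus_left csmult.minus_right
              ccross.minus_left ccross.minus_right) (simp add: add_eq_0_iff)
      qed
    qed
  qed
  have jP: "(j, True) \<in> P" using j by (simp add: P_def)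
  have "xd j t *s s j t + ccross (s j t) (pole_field N m0 s x j t) = 0"
    using fo[OF jP] j by (simp add: zd_eq S_eq r_eq b_eq)
  hence "xd j t = cdot (spin_axis (s j t)) (pole_field N m0 s x j t)"
    using first_order_iff_spin_axis[OF s0[OF j t], of "pole_field N m0 s x j t"]
      iso[OF jP t] con[OF jP t] j by (simp add: S_eq b_eq)
  thus ?thesis using dx[OF j t] by simp
qed

text \<open>The constant is independent of time: \<open>m\<close> has unit length, the spin axis is
  uniformly bounded, and only \<open>N - 1\<close> other poles enter the Blaschke estimate.\<close>

lemma Im_velocity_bound:
  assumes sol: "rational_solution \<sigma> N {0..} m0 s x m" and j: "j \<in> {1..N}" and \<eta>: "\<eta> > 0"
  obtains A where "A \<ge> 0" "\<And>t. \<lbrakk>t \<ge> 0; \<And>k. k \<in> {1..N} - {j}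
      \<Longrightarrow> \<bar>Re (x k t) - Re (x j t)\<bar> \<ge> \<eta>;
      Im (x j t) \<le> \<eta> / 4\<rbrakk>
    \<Longrightarrow> \<bar>Im (cdot (spin_axis (s j t)) (pole_field N m0 s x j t))\<bar> \<le> A * Im (x j t)"
proof -
  obtain Kc where Kc: "0 \<le> Kc" "\<And>u v. norm (ccross u v) \<le> norm u * norm v * Kc"
    using ccross.nonneg_bounded by blast
  obtain Kd where Kd: "0 \<le> Kd" "\<And>u v. norm (cdot u v) \<le> norm u * norm v * Kd"
    using cdot.nonneg_bounded by blast
  note sol' = sol[unfolded rational_solution_def half_wave_maps_def]
  show ?thesis
  proof (rule that[of "4 * 4 ^ (N - 1) * (Kc * Kd) / \<eta>"])
    show "4 * 4 ^ (N - 1) * (Kc * Kd) / \<eta> \<ge> 0" using Kc Kd \<eta> by simp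
    fix t :: real
    assume t: "t \<ge> 0"
      and sep: "\<And>k. k \<in> {1..N} - {j} \<Longrightarrow> \<bar>Re (x k t) - Re (x j t)\<bar> \<ge> \<eta>"
      and close: "Im (x j t) \<le> \<eta> / 4"
    have s0: "s j t \<noteq> 0" and up: "Im (x k t) > 0" if "k \<in> {1..N}" for k
      using sol' t j that by auto
    have m: "cvec (m y t) = cvec m0
        + \<i> *s (\<Sum>j\<in>{1..N}. (1 / (complex_of_real y - x j t)) *s s j t)
        - \<i> *s (\<Sum>j\<in>{1..N}. (1 / (complex_of_real y - cnj (x j t))) *s cnjv (s j t))" for y
      using sol' t by auto
    have sphere: "m y t \<in> sphere 0 1" for y using sol' t by auto
    define K where "K = {1..N} - {j}"
    define n where "n = spin_axis (s j t)"
    define \<alpha> where "\<alpha> k = - cdot n (s k t)" for k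
    define c where "c = Re (\<i> * cdot n (cvec m0))"
    \<comment> \<open>This is \<open>\<i> * cdot n m\<close> continued off the axis. The summand of
      \<open>j\<close> is absent since \<open>n\<close> is orthogonal to \<open>s j t\<close> and
      its conjugate, so \<open>h\<close> is regular at \<open>x j t\<close>.\<close>
    define h where "h z = of_real c + (\<Sum>k\<in>K. \<alpha> k / (z - x k t) + cnj (\<alpha> k) / (z - cnj (x k t)))" for z
    have cnj_n: "cnj (cdot n v) = - cdot n (cnjv v)" for v
      by (simp add: cnjv_cdot n_def cnjv_spin_axis cdot.minus_left)
    \<comment> \<open>Since \<open>n\<close> is purely imaginary and \<open>m0\<close> real, the
      constant term is real.\<close>
    have "cnj (\<i> * cdot n (cvec m0)) = \<i> * cdot n (cvec m0)"
      by (simp add: cnj_n)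
    hence c: "of_real c = \<i> * cdot n (cvec m0)"
      by (simp add: c_def complex_eq_iff)
    have cnj\<alpha>: "cnj (\<alpha> k) = cdot n (cnjv (s k t))" for k by (simp add: \<alpha>_def cnj_n)
    have sumK: "(\<Sum>k\<in>{1..N}. f k) = f j + (\<Sum>k\<in>K. f k)" for f :: "nat \<Rightarrow> complex"
      unfolding K_def using j by (intro sum.remove) auto
    have n0: "cdot n (s j t) = 0" "cdot n (cnjv (s j t)) = 0" by (simp_all add: n_def)
    \<comment> \<open>Evaluation at the pole: the terms of the field along \<open>s j t\<close> and
      its conjugate drop out, leaving exactly \<open>h\<close>.\<close>
    have velocity: "cdot n (pole_field N m0 s x j t) = h (x j t)"
      unfolding pole_field_def K_def[symmetric] h_def c cnj\<alpha>
      by (simp add: cdot.diff_right cdot.add_right cdot.sum_right sumK n0 \<alpha>_def sum.distrib sum_negf sum_subtractf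
          del: One_nat_def)
    have h_real: "h (of_real y) = \<i> * cdot n (cvec (m y t))" for y
      unfolding m h_def c cnj\<alpha>
      by (simp add: cdot.diff_right cdot.add_right cdot.sum_right sumK n0 \<alpha>_def sum.distrib sum_negf
          sum_subtractf distrib_left right_diff_distrib mult.assoc[symmetric] del: One_nat_def)
    have "norm (ccross (s j t) (cnjv (s j t))) \<le> (norm (s j t))\<^sup>2 * Kc"
      using Kc(2)[of "s j t" "cnjv (s j t)"] by (simp add: power2_eq_square)
    hence "norm n \<le> Kc"
      using s0[OF j] by (simp add: n_def spin_axis_def norm_smult_cvec cdot_cnjv_self norm_divide norm_power divide_le_eq mult.commute)
    hence h_bnd: "cmod (h (of_real y)) \<le> Kc * Kd" for y
    proof -
      have "cmod (h (of_real y)) = cmod (cdot n (cvec (m y t)))" by (simp add: h_real norm_mult)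
      also have "\<dots> \<le> norm n * norm (cvec (m y t)) * Kd" by (rule Kd)
      also have "\<dots> = norm n * Kd" using sphere[of y] by simp
      also have "\<dots> \<le> Kc * Kd" using \<open>norm n \<le> Kc\<close> Kd(1) by (rule mult_right_mono)
      finally show ?thesis .
    qed
    have "\<bar>Im (h (Complex (Re (x j t)) (Im (x j t))))\<bar> \<le> 4 * 4 ^ card K * (Kc * Kd) / \<eta> * Im (x j t)"
      unfolding h_def
      by (rule Im_bound_near_real_axis[OF _ _ _ \<eta> h_bnd[unfolded h_def]])
         (use up[OF j] up sep close in \<open>auto simp: K_def less_imp_le\<close>)
    moreover have "card K = N - 1" using j by (simp add: K_def)
    ultimately show "\<bar>Im (cdot (spin_axis (s j t)) (pole_field N m0 s x j t))\<bar>
        \<le> 4 * 4 ^ (N - 1) * (Kc * Kd) / \<eta> * Im (x j t)"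
      by (simp add: velocity n_def[symmetric])
  qed
qed

theorem theorem4p1:
  fixes \<sigma> :: real and N :: nat and m0 :: "real ^ 3"
    and s :: "nat \<Rightarrow> real \<Rightarrow> complex ^ 3" and x :: "nat \<Rightarrow> real \<Rightarrow> complex"
    and m :: "real \<Rightarrow> real \<Rightarrow> real ^ 3"
  assumes "\<sigma> = 1 \<or> \<sigma> = - 1"
    and "N \<ge> 1"
    and "rational_solution \<sigma> N {0..} m0 s x m"
    and "\<exists>\<eta>>0. \<forall>j\<in>{1..N}. \<forall>k\<in>{1..N}. j \<noteq> k \<longrightarrow>
           (\<forall>t>0. \<bar>Re (x k t) - Re (x j t)\<bar> \<ge> \<eta>)"
  shows "\<forall>j\<in>approaching_poles N x. \<exists>C>0. \<exists>D>0. \<forall>t>0. Im (x j t) \<ge> C * exp (- D * t)"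
proof
  fix j assume "j \<in> approaching_poles N x"
  hence j: "j \<in> {1..N}" by (simp add: approaching_poles_def)
  obtain \<eta> where \<eta>: "\<eta> > 0" and sep: "\<And>j k t. j \<in> {1..N}
      \<Longrightarrow> k \<in> {1..N} \<Longrightarrow> j \<noteq> k \<Longrightarrow> t > 0 \<Longrightarrow>
      \<bar>Re (x k t) - Re (x j t)\<bar> \<ge> \<eta>"
    using assms(4) by blast
  obtain A where A: "A \<ge> 0" and vel: "\<And>t. \<lbrakk>t \<ge> 0; \<And>k. k \<in> {1..N} - {j}
      \<Longrightarrow> \<bar>Re (x k t) - Re (x j t)\<bar> \<ge> \<eta>;
      Im (x j t) \<le> \<eta> / 4\<rbrakk>
    \<Longrightarrow> \<bar>Im (cdot (spin_axis (s j t)) (pole_field N m0 s x j t))\<bar> \<le> A * Im (x j t)"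
    using Im_velocity_bound[OF assms(3) j \<eta>] by blast
  note sol = assms(3)[unfolded rational_solution_def]
  define v where "v t = cdot (spin_axis (s j t)) (pole_field N m0 s x j t)" for t
  \<comment> \<open>Adding 1 makes the rate strictly positive even if \<open>A = 0\<close>.\<close>
  define D where "D = A + 1"
  have D: "D > 0" using A by (simp add: D_def)
  have pos: "Im (x j t) > 0" if "t \<ge> 0" for t using sol j that by auto
  have dx: "(x j has_vector_derivative v t) (at t within {0..})" if "t \<ge> 0" for t
    unfolding v_def by (rule rational_solution_velocity[OF assms(3) j that])
  \<comment> \<open>The threshold \<open>\<eta> / 4\<close> is the height below which the velocity
    bound applies; the minimum with the initial height is the constant \<open>C\<close>.\<close>
  have "Im (x j t) \<ge> min (Im (x j 0)) (\<eta> / 4) * exp (- D * t)" if t: "t \<ge> 0" for t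
  proof (rule exp_lower_bound[where y = "\<lambda>t. Im (x j t)" and y' = "\<lambda>t. Im (v t)"])
    have "continuous_on {0..} (x j)"
      using dx by (auto simp: continuous_on_eq_continuous_within intro!: has_vector_derivative_continuous)
    thus "continuous_on {0..} (\<lambda>t. Im (x j t))" by (intro continuous_intros)
    show "((\<lambda>t. Im (x j t)) has_real_derivative Im (v t)) (at t)" if "t > 0" for t
    proof -
      have "(x j has_vector_derivative v t) (at t)"
        using has_vector_derivative_within_subset[OF dx, of t "{0<..}"] that
        by (simp add: at_within_open[of t "{0<..}"] subset_iff)
      thus ?thesis
        unfolding has_real_derivative_iff_has_vector_derivative
        by (rule bounded_linear.has_vector_derivative[OF bounded_linear_Im])
    qed
    show "Im (v t) \<ge> - D * Im (x j t)" if t: "t > 0" "Im (x j t) \<le> \<eta> / 4" for t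
    proof -
      have "\<bar>Im (v t)\<bar> \<le> A * Im (x j t)"
        unfolding v_def by (rule vel) (use j t sep in auto)
      also have "\<dots> \<le> D * Im (x j t)"
        using pos[of t] t by (intro mult_right_mono) (auto simp: D_def)
      finally show ?thesis by simp
    qed
  qed (use pos \<eta> D t in auto)
  moreover have "min (Im (x j 0)) (\<eta> / 4) > 0" using pos[of 0] \<eta> by simp
  ultimately show "\<exists>C>0. \<exists>D>0. \<forall>t>0. Im (x j t) \<ge> C * exp (- D * t)"
    using D by (intro exI[of _ "min (Im (x j 0)) (\<eta> / 4)"] exI[of _ D] conjI) auto
qed

end
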